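(* Let $n\geq 8$. Then $R(S_n(1,4),W_8)=2n-1$ if $n\not\equiv 0\pmod 4$, and $R(S_n(1,4),W_8)=2n$ if $n\equiv 0\pmod 4$.
   Context: All graphs are finite and simple. For graphs $G,H$, $R(G,H)$ is the smallest $N$ such that every graph $F$ of order $N$ either contains $G$ as a subgraph or has complement $\overline{F}$ containing $H$. $W_8$ is the wheel of order 9 (a hub joined to every vertex of a cycle $C_8$). $S_k$ is the star of order $k$. $S_n(1,4)$ is the tree of order $n$ obtained from $S_{n-4}$ by subdividing one edge four times, i.e. a center adjacent to $n-6$ leaves together with a pendant path of 5 edges starting at the center. *)

theory Defs
  imports "Graph_Theory.Graph_Theory"
begin

text \<open>
  A finite simple graph is a \<open>pair_pre_digraph\<close> satisfying \<open>pair_graph\<close>: finite vertex set, no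
  loops, and a symmetric arc relation, each undirected edge being present as a pair of opposite
  arcs.
\<close>

definition complement :: "'a pair_pre_digraph \<Rightarrow> 'a pair_pre_digraph" where
  "complement F =
     \<lparr> pverts = pverts F,
       parcs = {(u, v). u \<in> pverts F \<and> v \<in> pverts F \<and> u \<noteq> v \<and> (u, v) \<notin> parcs F} \<rparr>"

text \<open>Containment is as a subgraph up to isomorphism, not necessarily induced.\<close>

definition contains :: "'a pair_pre_digraph \<Rightarrow> 'b pair_pre_digraph \<Rightarrow> bool" where
  "contains F G \<longleftrightarrow>
     (\<exists>H :: 'a pair_pre_digraph.
        subgraph (with_proj H) (with_proj F) \<and> digraph_iso (with_proj G) (with_proj H))"

text \<open>
  It suffices to let \<open>F\<close> range over graphs with vertices in \<open>nat\<close>, since every finite graph is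
  isomorphic to one of these. For finite simple \<open>G\<close> and \<open>H\<close> the minimum exists by Ramsey's theorem.
\<close>

definition ramsey_number :: "'a pair_pre_digraph \<Rightarrow> 'b pair_pre_digraph \<Rightarrow> nat" where
  "ramsey_number G H =
     (LEAST N. \<forall>F :: nat pair_pre_digraph.
        pair_graph F \<and> card (pverts F) = N \<longrightarrow> contains F G \<or> contains (complement F) H)"

definition star :: "nat \<Rightarrow> nat pair_pre_digraph" where
  "star k =
     \<lparr> pverts = {..<k},
       parcs = {0} \<times> {1..<k} \<union> {1..<k} \<times> {0} \<rparr>"

text \<open>
  The new vertices are \<open>n - 4, \<dots>, n - 1\<close>; for \<open>n \<ge> 6\<close> the subdivided edge \<open>{0, 1}\<close> of the star
  becomes the path \<open>0, n - 1, n - 2, n - 3, n - 4, 1\<close>.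
\<close>

definition star_1_4 :: "nat \<Rightarrow> nat pair_pre_digraph" where
  "star_1_4 n =
     subdivide (subdivide (subdivide (subdivide (star (n - 4))
       (0, 1) (n - 4)) (0, n - 4) (n - 3)) (0, n - 3) (n - 2)) (0, n - 2) (n - 1)"

definition cycle_arcs :: "nat \<Rightarrow> nat rel" where
  "cycle_arcs m = {(i, Suc i mod m) | i. i < m} \<union> {(Suc i mod m, i) | i. i < m}"

text \<open>The hub is the vertex \<open>m\<close>, so that the wheel has order \<open>m + 1\<close>; intended for \<open>m \<ge> 3\<close>.\<close>

definition wheel :: "nat \<Rightarrow> nat pair_pre_digraph" where
  "wheel m =
     \<lparr> pverts = {..m},
       parcs = cycle_arcs m \<union> {m} \<times> {..<m} \<union> {..<m} \<times> {m} \<rparr>"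

lemma star_1_4_explicit:
  assumes "n \<ge> 6"
  shows "pverts (star_1_4 n) = {..<n}"
    and "parcs (star_1_4 n) =
      ({0} \<times> {2..<n - 4} \<union> {2..<n - 4} \<times> {0}) \<union>
      {(0, n - 1), (n - 1, 0), (n - 1, n - 2), (n - 2, n - 1), (n - 2, n - 3), (n - 3, n - 2),
       (n - 3, n - 4), (n - 4, n - 3), (n - 4, 1), (1, n - 4)}"
proof -
  obtain k where n: "n = k + 6"
    using assms by (metis add.commute le_Suc_ex)
  show "pverts (star_1_4 n) = {..<n}"
    by (auto simp: star_1_4_def star_def subdivide.simps n)
  define L where "L = {0} \<times> {2..<k + 2} \<union> {2..<k + 2} \<times> {0 :: nat}"
  have star: "parcs (star (n - 4)) = L \<union> {(0, 1), (1, 0)}"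
  proof -
    have "{1..<k + 2} = insert 1 {2..<k + 2}" by auto
    then show ?thesis unfolding star_def L_def by (simp add: n) blast
  qed
  have sd: "parcs (subdivide G (0, x) w) =
      L \<union> ((P - {(0, x), (x, 0)}) \<union> {(0, w), (w, 0), (w, x), (x, w)})"
    if "parcs G = L \<union> P" "x = 1 \<or> x \<ge> k + 2" for G P x w
  proof -
    have "L - {(0, x), (x, 0)} = L"
      using that(2) by (auto simp: L_def)
    then show ?thesis
      by (simp add: subdivide.simps that(1) Un_Diff Un_assoc)
  qed
  have "parcs (star_1_4 n) = L \<union>
      {(0, n - 1), (n - 1, 0), (n - 1, n - 2), (n - 2, n - 1), (n - 2, n - 3), (n - 3, n - 2),
       (n - 3, n - 4), (n - 4, n - 3), (n - 4, 1), (1, n - 4)}"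
    unfolding star_1_4_def
    by (subst sd, rule sd, rule sd, rule sd, rule star) (simp_all add: n)
  then show "parcs (star_1_4 n) =
      ({0} \<times> {2..<n - 4} \<union> {2..<n - 4} \<times> {0}) \<union>
      {(0, n - 1), (n - 1, 0), (n - 1, n - 2), (n - 2, n - 1), (n - 2, n - 3), (n - 3, n - 2),
       (n - 3, n - 4), (n - 4, n - 3), (n - 4, 1), (1, n - 4)}"
    by (simp add: n L_def)
qed

lemma pair_graph_star_1_4:
  assumes "n \<ge> 6"
  shows "pair_graph (star_1_4 n)"
proof -
  have "finite (parcs (star_1_4 n))"
    unfolding star_1_4_explicit(2)[OF assms] by simp
  moreover have "sym (parcs (star_1_4 n))"
    unfolding star_1_4_explicit(2)[OF assms] by (rule symI) auto
  ultimately show ?thesis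
    using assms by unfold_locales (auto simp: star_1_4_explicit symmetric_def)
qed

lemma pair_graph_wheel:
  assumes "m \<ge> 3"
  shows "pair_graph (wheel m)"
proof -
  have sub: "parcs (wheel m) \<subseteq> {..m} \<times> {..m}"
    using assms by (auto simp: wheel_def cycle_arcs_def intro: less_imp_le)
  then have fin: "finite (parcs (wheel m))"
    by (rule finite_subset) simp
  have "sym (parcs (wheel m))"
    by (rule symI) (auto simp: wheel_def cycle_arcs_def)
  moreover have "fst e \<noteq> snd e" if "e \<in> parcs (wheel m)" for e
    using that assms by (auto simp: wheel_def cycle_arcs_def mod_Suc split: if_splits)
  ultimately show ?thesis
    using sub fin by unfold_locales (auto simp: symmetric_def wheel_def)
qed

lemma contains_iff_embedding:
  assumes "pair_graph F" "pair_graph G"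
  shows "contains F G \<longleftrightarrow>
    (\<exists>f. inj_on f (pverts G) \<and> f ` pverts G \<subseteq> pverts F \<and>
         (\<forall>u v. (u, v) \<in> parcs G \<longrightarrow> (f u, f v) \<in> parcs F))"
proof
  assume "contains F G"
  then obtain H h where sub: "subgraph (with_proj H) (with_proj F)"
    and h: "pre_digraph.digraph_isomorphism (with_proj G) h"
    and H: "with_proj H = app_iso h (with_proj G)"
    by (auto simp: contains_def digraph_iso_def)
  have VH: "pverts H = iso_verts h ` pverts G" and AH: "parcs H = iso_arcs h ` parcs G"
    and tH: "iso_tail h = fst" and hH: "iso_head h = snd"
    using arg_cong[OF H, of verts] arg_cong[OF H, of arcs]
      arg_cong[OF H, of tail] arg_cong[OF H, of head] by (auto simp: app_iso_def)
  have HF: "pverts H \<subseteq> pverts F" "parcs H \<subseteq> parcs F"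
    using sub by (auto simp: subgraph_def)
  have inj: "inj_on (iso_verts h) (pverts G)"
    using h by (auto simp: pre_digraph.digraph_isomorphism_def)
  have "(iso_verts h u, iso_verts h v) \<in> parcs F" if "(u, v) \<in> parcs G" for u v
  proof -
    have "iso_verts h u = fst (iso_arcs h (u, v))" "iso_verts h v = snd (iso_arcs h (u, v))"
      using h that tH hH by (auto simp: pre_digraph.digraph_isomorphism_def)
    then have "(iso_verts h u, iso_verts h v) = iso_arcs h (u, v)" by simp
    then show ?thesis using that AH HF by auto
  qed
  then show "\<exists>f. inj_on f (pverts G) \<and> f ` pverts G \<subseteq> pverts F \<and>
         (\<forall>u v. (u, v) \<in> parcs G \<longrightarrow> (f u, f v) \<in> parcs F)"
    using inj VH HF by (intro exI[of _ "iso_verts h"]) auto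
next
  assume "\<exists>f. inj_on f (pverts G) \<and> f ` pverts G \<subseteq> pverts F \<and>
         (\<forall>u v. (u, v) \<in> parcs G \<longrightarrow> (f u, f v) \<in> parcs F)"
  then obtain f where inj: "inj_on f (pverts G)" and V: "f ` pverts G \<subseteq> pverts F"
    and A: "\<And>u v. (u, v) \<in> parcs G \<Longrightarrow> (f u, f v) \<in> parcs F" by blast
  interpret F: pair_graph F by fact
  interpret G: pair_graph G by fact
  define h where "h = \<lparr> iso_verts = f, iso_arcs = map_prod f f, iso_head = snd, iso_tail = fst \<rparr>"
  define H where "H = \<lparr> pverts = f ` pverts G, parcs = map_prod f f ` parcs G \<rparr>"
  have "inj_on (map_prod f f) (parcs G)"
    by (rule inj_on_subset[OF map_prod_inj_on[OF inj inj]]) (auto dest: G.in_arcsD1 G.in_arcsD2)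
  then have "pre_digraph.digraph_isomorphism (with_proj G) h"
    using inj G.wf_digraph
    by (auto simp: pre_digraph.digraph_isomorphism_def h_def)
  moreover have "with_proj H = app_iso h (with_proj G)"
    by (simp add: with_proj_def app_iso_def h_def H_def)
  ultimately have "digraph_iso (with_proj G) (with_proj H)"
    by (auto simp: digraph_iso_def)
  moreover have "pair_wf_digraph H"
    by unfold_locales (auto simp: H_def dest: G.in_arcsD1 G.in_arcsD2)
  then have "subgraph (with_proj H) (with_proj F)"
    using V A F.wf_digraph
    by (auto simp: subgraph_def compatible_def wf_digraph_wp_iff H_def)
  ultimately show "contains F G" by (auto simp: contains_def)
qed

end

theory Submission
  imports Defs
begin

text \<open>
  Let \<open>F\<close> be a counterexample to the upper bound. If every degree is at most \<open>n - 6\<close>, then all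
  neighbourhoods in the complement are large, and comparing codegrees inside such a neighbourhood
  yields a \<open>C\<^sub>8\<close>. Otherwise take \<open>v\<close> of degree at least \<open>n - 5\<close>, and let \<open>U\<close> be the set of its
  non-neighbours, so that \<open>U\<close> has no \<open>C\<^sub>8\<close> in the complement.

  If \<open>U\<close> has at least \<open>9\<close> vertices, then no path on four vertices in \<open>U\<close> may start next to a
  neighbour of \<open>v\<close>. This forces all but at most three vertices of \<open>U\<close> to have no edge to the rest of the
  graph; so the complement contains a complete bipartite graph on all vertices. Then each vertex
  has at most three non-neighbours on its own side, since otherwise it is the hub of a wheel. A
  side of at least \<open>n\<close> vertices therefore contains the tree unless it is \<open>K\<^bsub>4,...,4\<^esub>\<close> on exactly \<open>n\<close>
  vertices; this is why divisibility by \<open>4\<close> matters. If \<open>U\<close> has at most \<open>8\<close> vertices,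
  then no path on five vertices avoiding \<open>v\<close> may start at a neighbour of \<open>v\<close>. Maximal paths then end in vertices of
  degree at most three, and five of these, chosen successively, span a wheel with the other vertices.

  The lower bounds come from two copies of \<open>K\<^bsub>n-1\<^esub>\<close> and, for \<open>4\<close> dividing \<open>n\<close>, from
  the disjoint union of \<open>K\<^bsub>n-1\<^esub>\<close> and \<open>K\<^bsub>4,...,4\<^esub>\<close>.
\<close>

section \<open>Representatives and cycles in small set systems\<close>

lemma card_less_obtain:
  assumes "finite T" "card T < card S"
  obtains x where "x \<in> S" "x \<notin> T"
  using assms by (metis card_mono linorder_not_less subsetI)

lemma distinct_list_of_card:
  assumes "k \<le> card S"
  obtains xs where "length xs = k" "distinct xs" "set xs \<subseteq> S"
proof -
  obtain T where "T \<subseteq> S" "card T = k" "finite T" using assms by (meson obtain_subset_with_card_n)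
  then show thesis using that finite_distinct_list[of T] distinct_card by metis
qed

lemma card_pos_obtain:
  assumes "0 < card S"
  obtains x where "x \<in> S"
  using assms by fastforce

lemma two_of_card:
  assumes "2 \<le> card S"
  obtains a b where "a \<in> S" "b \<in> S" "a \<noteq> b"
proof -
  obtain xs where xs: "length xs = 2" "distinct xs" "set xs \<subseteq> S" by (rule distinct_list_of_card[OF assms])
  then obtain a b where "xs = [a, b]" by (auto simp: numeral_eq_Suc length_Suc_conv)
  then show thesis using that xs by auto
qed

lemma four_of_card:
  assumes "4 \<le> card S"
  obtains a b c d where "{a, b, c, d} \<subseteq> S" "distinct [a, b, c, d]"
proof -
  obtain xs where xs: "length xs = 4" "distinct xs" "set xs \<subseteq> S" by (rule distinct_list_of_card[OF assms])
  then obtain a b c d where "xs = [a, b, c, d]" by (auto simp: numeral_eq_Suc length_Suc_conv)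
  then show thesis using that xs by auto
qed

section \<open>Hall's theorem and alternating cycles\<close>

lemma hall_marriage:
  assumes "finite I" "\<And>i. i \<in> I \<Longrightarrow> finite (A i)" "\<And>J. J \<subseteq> I \<Longrightarrow> card J \<le> card (\<Union>(A ` J))"
  shows "\<exists>R. inj_on R I \<and> (\<forall>i\<in>I. R i \<in> A i)"
  using assms
proof (induction "card I" arbitrary: I A rule: less_induct)
  case less
  show ?case
  proof (cases "I = {}")
    case False
    then obtain i where i: "i \<in> I" by blast
    show ?thesis
    proof (cases "\<exists>J. J \<subset> I \<and> J \<noteq> {} \<and> card (\<Union>(A ` J)) = card J")
      \<comment> \<open>No nonempty proper subfamily is tight, so each such union has an element to
        spare and any representative \<open>x\<close> of \<open>i\<close> may be removed from the
        other sets.\<close>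
      case False
      have "card {i} \<le> card (\<Union>(A ` {i}))" using less.prems(3)[of "{i}"] i by simp
      then obtain x where x: "x \<in> A i" by fastforce
      define B where "B = (\<lambda>j. A j - {x})"
      have "\<exists>R. inj_on R (I - {i}) \<and> (\<forall>j\<in>I - {i}. R j \<in> B j)"
      proof (rule less.hyps)
        show "card (I - {i}) < card I"
          using i less.prems(1) by (rule card_Diff1_less[rotated])
        show "finite (I - {i})" using less.prems(1) by simp
        show "finite (B j)" if "j \<in> I - {i}" for j using that less.prems(2) by (simp add: B_def)
        show "card J \<le> card (\<Union>(B ` J))" if J: "J \<subseteq> I - {i}" for J
        proof (cases "J = {}")
          case nonempty: False
          have "J \<subset> I" using J i by blast
          then have "card J \<noteq> card (\<Union>(A ` J))" using False nonempty by metis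
          then have "card J < card (\<Union>(A ` J))"
            using less.prems(3)[of J] \<open>J \<subset> I\<close> by (meson order.not_eq_order_implies_strict psubset_imp_subset)
          moreover have "\<Union>(B ` J) = \<Union>(A ` J) - {x}" by (auto simp: B_def)
          moreover have "finite (\<Union>(A ` J))"
            using \<open>J \<subset> I\<close> less.prems(1,2) by (meson finite_UN finite_subset psubset_imp_subset subsetD)
          ultimately show ?thesis by (auto simp: card_Diff_singleton_if)
        qed simp
      qed
      then obtain R where R: "inj_on R (I - {i})" "\<forall>j\<in>I - {i}. R j \<in> B j" by blast
      have "inj_on (R(i := x)) I"
        using R unfolding inj_on_def B_def by auto
      moreover have "\<forall>j\<in>I. (R(i := x)) j \<in> A j" using R x by (auto simp: B_def)
      ultimately show ?thesis by blast
    next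
      case True
      then obtain J where J: "J \<subset> I" "J \<noteq> {}" "card (\<Union>(A ` J)) = card J" by blast
      define U where "U = \<Union>(A ` J)"
      have fJ: "finite J" using J(1) less.prems(1) by (meson finite_subset psubset_imp_subset)
      have "\<exists>R. inj_on R J \<and> (\<forall>j\<in>J. R j \<in> A j)"
        by (rule less.hyps) (use J fJ less.prems in \<open>auto intro: psubset_card_mono\<close>)
      then obtain R where R: "inj_on R J" "\<forall>j\<in>J. R j \<in> A j" by blast
      \<comment> \<open>Away from the tight family \<open>J\<close> the elements of \<open>U\<close>
        may be given up: subtracting the equality for \<open>J\<close> from Hall's condition for
        \<open>K \<union> J\<close> leaves it for \<open>K\<close>.\<close>
      have "\<exists>S. inj_on S (I - J) \<and> (\<forall>j\<in>I - J. S j \<in> A j - U)"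
      proof (rule less.hyps)
        show "card (I - J) < card I"
          using J less.prems(1) by (intro psubset_card_mono) auto
        show "finite (I - J)" using less.prems(1) by simp
        show "finite (A j - U)" if "j \<in> I - J" for j using that less.prems(2) by simp
        show "card K \<le> card (\<Union>j\<in>K. A j - U)" if K: "K \<subseteq> I - J" for K
        proof -
          have fK: "finite K" using K less.prems(1) by (meson finite_Diff finite_subset)
          have "card K + card J = card (K \<union> J)" using K fJ fK by (subst card_Un_disjoint) auto
          also have "\<dots> \<le> card (\<Union>(A ` (K \<union> J)))" using K J by (intro less.prems(3)) auto
          also have "\<Union>(A ` (K \<union> J)) = (\<Union>j\<in>K. A j - U) \<union> U" by (auto simp: U_def)
          also have "card \<dots> \<le> card (\<Union>j\<in>K. A j - U) + card U" by (rule card_Un_le)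
          finally show ?thesis using J(3) U_def by simp
        qed
      qed
      then obtain S where S: "inj_on S (I - J)" "\<forall>j\<in>I - J. S j \<in> A j - U" by blast
      define Q where "Q = (\<lambda>j. if j \<in> J then R j else S j)"
      have RU: "R j \<in> U" if "j \<in> J" for j using R that by (auto simp: U_def)
      have "inj_on Q I"
        using R(1) S RU unfolding inj_on_def Q_def by (metis DiffD2 DiffI)
      moreover have "\<forall>j\<in>I. Q j \<in> A j" using R(2) S(2) by (auto simp: Q_def)
      ultimately show ?thesis by blast
    qed
  qed simp
qed

text \<open>This is Hall's condition written out for four sets, which will be the intersections of
  cyclically consecutive neighbourhoods.\<close>

lemma four_distinct_representatives:
  assumes fin: "finite A" "finite B" "finite C" "finite D"
    and two: "2 \<le> card A" "2 \<le> card B" "2 \<le> card C" "2 \<le> card D"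
    and three: "3 \<le> card (A \<union> B \<union> C)" "3 \<le> card (B \<union> C \<union> D)" "3 \<le> card (C \<union> D \<union> A)"
      "3 \<le> card (D \<union> A \<union> B)"
    and four: "4 \<le> card (A \<union> B \<union> C \<union> D)"
  obtains a b c d where "a \<in> A" "b \<in> B" "c \<in> C" "d \<in> D" "distinct [a, b, c, d]"
proof -
  define F where "F = (\<lambda>i. [A, B, C, D] ! i)"
  have F: "F 0 = A" "F 1 = B" "F 2 = C" "F 3 = D" by (simp_all add: F_def)
  have I: "{..<4::nat} = {0, 1, 2, 3}" by auto
  have "\<exists>R. inj_on R {..<4::nat} \<and> (\<forall>i\<in>{..<4}. R i \<in> F i)"
  proof (rule hall_marriage)
    show finF: "finite (F i)" if "i \<in> {..<4}" for i using that fin F unfolding I by auto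
    show "card J \<le> card (\<Union>(F ` J))" if "J \<subseteq> {..<4}" for J
    proof -
      have finU: "finite (\<Union>(F ` J))" 
        using finite_subset[OF that finite_lessThan] finF that by (intro finite_UN_I) auto
      have sub: "card S \<le> card (\<Union>(F ` J))" if "S \<subseteq> \<Union>(F ` J)" for S
        using finU that by (rule card_mono)
      have J4: "card J + card ({..<4} - J) = 4"
        using that by (metis card_Diff_subset card_lessThan card_mono finite_lessThan finite_subset le_add_diff_inverse)
      consider "J = {}" | i where "i \<in> J" "card J \<le> 2" | i where "{..<4} - J = {i}" "card J = 3"
        | "{..<4} - J = {}" "card J = 4"
      proof (cases "card J \<le> 2")
        case False
        then consider "card ({..<4} - J) = 1" "card J = 3" | "card ({..<4} - J) = 0" "card J = 4"
          using J4 by linarith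
        then show ?thesis
        proof cases
          case 1
          then show ?thesis using that(3) card_1_singletonE by metis
        next
          case 2
          then show ?thesis using that(4) by (metis card_0_eq finite_Diff finite_lessThan)
        qed
      qed (use that(1,2) in blast)
      then show ?thesis
      proof cases
        case (2 i)
        then have "2 \<le> card (F i)" using two F \<open>J \<subseteq> {..<4}\<close> unfolding I by auto
        moreover have "card (F i) \<le> card (\<Union>(F ` J))" using 2 by (intro sub) auto
        ultimately show ?thesis using 2 by linarith
      next
        case (3 i)
        then have "J = {..<4} - {i}" "i \<in> {..<4}" using \<open>J \<subseteq> {..<4}\<close> by blast+
        then have "J = {0, 1, 2, 3} - {i}" "i \<in> {0, 1, 2, 3}" by (simp_all only: I)
        then consider "J = {1, 2, 3}" | "J = {2, 3, 0}" | "J = {3, 0, 1}" | "J = {0, 1, 2}"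
          by (elim insertE emptyE) (simp_all add: insert_Diff_if insert_commute)
        then have "3 \<le> card (\<Union>(F ` J))" by cases (use F three in \<open>simp_all add: Un_assoc\<close>)
        then show ?thesis using 3 by simp
      next
        case 4
        then have "J = {0, 1, 2, 3}" using \<open>J \<subseteq> {..<4}\<close> unfolding I by blast
        then have "\<Union>(F ` J) = A \<union> B \<union> C \<union> D" using F by auto
        then show ?thesis using 4 four by simp
      qed simp
    qed
  qed simp
  then obtain R where R: "inj_on R {..<4::nat}" "\<forall>i\<in>{..<4}. R i \<in> F i" by blast
  have "distinct [R 0, R 1, R 2, R 3]" using R(1) unfolding I inj_on_def by auto
  moreover have "R 0 \<in> A" "R 1 \<in> B" "R 2 \<in> C" "R 3 \<in> D"
    using R(2) F by (auto simp: I)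
  ultimately show thesis using that by blast
qed

text \<open>
  Any two of the sets \<open>N x\<close> share two elements, so Hall's condition for a given cyclic order fails only
  if three consecutive intersections lie in a common pair, or all four in a common triple. In the first case the
  sets coincide alternately and another order works; if the second case occurs for every order,
  all intersections are the same triple, which contradicts the sizes.
\<close>

lemma alternating_cycle:
  assumes finY: "finite Y" and Y5: "5 \<le> card Y" and X4: "card X = 4"
    and N: "\<And>x. x \<in> X \<Longrightarrow> N x \<subseteq> Y"
    and deg: "\<And>x x'. x \<in> X \<Longrightarrow> x' \<in> X \<Longrightarrow> x \<noteq> x' \<Longrightarrow> card Y + 2 \<le> card (N x) + card (N x')"
  obtains a b c d p q r s where "X = {a, b, c, d}" "distinct [a, b, c, d]" "distinct [p, q, r, s]"
    "p \<in> N a \<inter> N b" "q \<in> N b \<inter> N c" "r \<in> N c \<inter> N d" "s \<in> N d \<inter> N a"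
proof (rule ccontr)
  assume no: "\<not> thesis"
  note cycle = that
  have finX: "finite X" using X4 card.infinite by fastforce
  have finN: "finite (N x)" if "x \<in> X" for x using that N finY finite_subset by blast
  have Xeq: "X = {a, b, c, d}" if "{a, b, c, d} \<subseteq> X" "distinct [a, b, c, d]" for a b c d
    by (rule card_subset_eq[symmetric]) (use finX that X4 in auto)
  have bad: False if "{a, b, c, d} \<subseteq> X" "distinct [a, b, c, d]" "distinct [p, q, r, s]"
    "p \<in> N a \<inter> N b" "q \<in> N b \<inter> N c" "r \<in> N c \<inter> N d" "s \<in> N d \<inter> N a" for a b c d p q r s
    using no cycle[OF Xeq[OF that(1,2)] that(2-7)] by blast
  have IE: "card (N x \<union> N y) + card (N x \<inter> N y) = card (N x) + card (N y)" if "x \<in> X" "y \<in> X" for x y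
    using card_Un_Int[of "N x" "N y"] finN that by simp
  have two: "2 \<le> card (N x \<inter> N y)" if "x \<in> X" "y \<in> X" "x \<noteq> y" for x y
  proof -
    have "card (N x \<union> N y) \<le> card Y" using N that finY by (intro card_mono) auto
    then show ?thesis using IE[of x y] deg[of x y] that by linarith
  qed
  have three: "3 \<le> card (N a \<inter> N b \<union> N b \<inter> N c \<union> N c \<inter> N d)"
    if X: "{a, b, c, d} \<subseteq> X" and dist: "distinct [a, b, c, d]" for a b c d
  proof (rule ccontr)
    let ?U = "N a \<inter> N b \<union> N b \<inter> N c \<union> N c \<inter> N d"
    assume "\<not> 3 \<le> card ?U"
    then have U2: "card ?U \<le> 2" by simp
    have finU: "finite ?U" using finN X by auto
    have eq: "S = ?U" if "S \<subseteq> ?U" "2 \<le> card S" for S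
      using card_seteq[OF finU that(1)] U2 that(2) by linarith
    have ab: "N a \<inter> N b = ?U" and bc: "N b \<inter> N c = ?U" and cd: "N c \<inter> N d = ?U"
      by (rule eq; use two X dist in auto)+
    have U: "card ?U = 2" using two[of a b] ab U2 X dist by auto
    \<comment> \<open>An intersection of size two makes inclusion-exclusion tight, so the two sets
      cover \<open>Y\<close>; this forces \<open>N a = N c\<close> and
      \<open>N b = N d\<close>.\<close>
    have full: "N x \<union> N y = Y" if "x \<in> X" "y \<in> X" "x \<noteq> y" "N x \<inter> N y = ?U" for x y
      by (rule card_seteq) (use that finY N IE[of x y] deg[of x y] U in auto)
    have Yab: "N a \<union> N b = Y" and Ybc: "N b \<union> N c = Y" and Ycd: "N c \<union> N d = Y"
      by (rule full; use ab bc cd X dist in auto)+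
    have ac: "N a = N c" using ab bc Yab Ybc by blast
    have bd: "N b = N d" using bc cd Ybc Ycd by blast
    obtain p q where pq: "?U = {p, q}" "p \<noteq> q" using U by (meson card_2_iff)
    have four: "4 \<le> card (N x)" if "x = a \<or> x = b" for x
      using that deg[of a c] deg[of b d] ac bd X dist Y5 by auto
    obtain r where r: "r \<in> N a" "r \<notin> {p, q}"
      by (rule card_less_obtain[of "{p, q}" "N a"]) (use four[of a] pq in auto)
    obtain s where s: "s \<in> N b" "s \<notin> {p, q}"
      by (rule card_less_obtain[of "{p, q}" "N b"]) (use four[of b] pq in auto)
    have "r \<noteq> s" using r s ab pq by blast
    have pqab: "p \<in> N a" "p \<in> N b" "q \<in> N a" "q \<in> N b" using ab pq by auto
    \<comment> \<open>In the order \<open>a, c, b, d\<close>, the vertices \<open>r\<close> and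
      \<open>s\<close> join the pairs with equal sets, and \<open>p\<close> and \<open>q\<close>
      join the mixed pairs.\<close>
    show False
      by (rule bad[of a c b d r p s q]) (use X dist r s \<open>r \<noteq> s\<close> pq pqab ac bd in auto)
  qed
  have le3: "card ((N a \<union> N c) \<inter> (N b \<union> N d)) \<le> 3"
    if X: "{a, b, c, d} \<subseteq> X" and dist: "distinct [a, b, c, d]" for a b c d
  proof (rule ccontr)
    assume "\<not> ?thesis"
    moreover have "(N a \<union> N c) \<inter> (N b \<union> N d) = N a \<inter> N b \<union> N b \<inter> N c \<union> N c \<inter> N d \<union> N d \<inter> N a"
      by auto
    ultimately have 4: "4 \<le> card (N a \<inter> N b \<union> N b \<inter> N c \<union> N c \<inter> N d \<union> N d \<inter> N a)" by simp
    obtain p q r s where "p \<in> N a \<inter> N b" "q \<in> N b \<inter> N c" "r \<in> N c \<inter> N d" "s \<in> N d \<inter> N a"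
      "distinct [p, q, r, s]"
      by (rule four_distinct_representatives[OF _ _ _ _ _ _ _ _ _ _ _ _ 4])
        (use finN two three[of a b c d] three[of b c d a] three[of c d a b] three[of d a b c]
          X dist in auto)
    then show False using bad X dist by blast
  qed
  obtain a b c d where abcd: "X = {a, b, c, d}" "distinct [a, b, c, d]"
  proof -
    obtain xs where "set xs = X" "distinct xs" using finX finite_distinct_list by blast
    moreover from this have "length xs = 4" using X4 distinct_card by fastforce
    then obtain a b c d where "xs = [a, b, c, d]"
      by (auto simp: numeral_eq_Suc length_Suc_conv)
    ultimately show thesis using that by auto
  qed
  have int3: "card (N x \<inter> N y) \<le> 3" if "{x, y, z, w} \<subseteq> X" "distinct [x, y, z, w]" for x y z w
  proof -
    have "card (N x \<inter> N y) \<le> card ((N x \<union> N z) \<inter> (N y \<union> N w))"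
      using that finN by (intro card_mono) auto
    also have "\<dots> \<le> 3" using le3[of x y z w] that by simp
    finally show ?thesis .
  qed
  have sum: "card Y + 1 \<le> card (N x \<inter> N z) + card (N y \<inter> N w)"
    if "{x, y, z, w} \<subseteq> X" "distinct [x, y, z, w]" for x y z w
  proof -
    have "card (N x \<union> N z) + card (N y \<union> N w)
        = card (N x \<union> N z \<union> (N y \<union> N w)) + card ((N x \<union> N z) \<inter> (N y \<union> N w))"
      by (rule card_Un_Int) (use finN that in auto)
    also have "\<dots> \<le> card Y + 3"
      using le3[of x y z w] that N finY by (intro add_mono card_mono) auto
    finally show ?thesis
      using IE[of x z] IE[of y w] deg[of x z] deg[of y w] that by simp
  qed
  \<comment> \<open>Each of the three splittings of \<open>X\<close> into pairs gives
    \<open>6 <= card Y + 1 <= 3 + 3\<close>, so every bound is attained.\<close>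
  have Y: "card Y = 5" and c3: "card (N a \<inter> N b) = 3" "card (N a \<inter> N c) = 3" "card (N a \<inter> N d) = 3"
    "card (N b \<inter> N c) = 3" "card (N b \<inter> N d) = 3" "card (N c \<inter> N d) = 3"
    using sum[of a b c d] sum[of a c b d] sum[of a b d c]
      int3[of a b c d] int3[of a c b d] int3[of a d b c] int3[of b c a d] int3[of b d a c] int3[of c d a b]
      abcd Y5 by auto
  define D where "D = (N a \<union> N c) \<inter> (N b \<union> N d)"
  have finD: "finite D" and D3: "card D \<le> 3" using le3[of a b c d] abcd finN by (auto simp: D_def)
  have eqD: "S = D" if "S \<subseteq> D" "card S = 3" for S
    using card_seteq[OF finD that(1)] that(2) D3 by linarith
  have ab: "N a \<inter> N b = D" and bc: "N b \<inter> N c = D" and cd: "N c \<inter> N d = D" and ad: "N a \<inter> N d = D"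
    by (rule eqD; use c3 in \<open>auto simp: D_def\<close>)+
  have D: "card D = 3" using c3 ab by metis
  have sub: "D \<subseteq> N a" "D \<subseteq> N b" "D \<subseteq> N c" "D \<subseteq> N d" using ab bc cd by auto
  have ac: "N a \<inter> N c = D"
    by (rule card_seteq[symmetric]) (use sub c3 D finN abcd in auto)
  have bd: "N b \<inter> N d = D"
    by (rule card_seteq[symmetric]) (use sub c3 D finN abcd in auto)
  \<comment> \<open>These parts are disjoint and share the two elements of \<open>Y - D\<close>. Any
    two of the sets have total size at least 7, so at most one part is empty, which needs three
    elements.\<close>
  define P where "P x = N x - D" for x
  have finP: "finite (P x)" if "x \<in> X" for x using finN that by (simp add: P_def)
  have size: "card (P x) + 3 = card (N x)" if "x \<in> X" "D \<subseteq> N x" for x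
    using card_Un_Int[of "P x" D] finN[OF that(1)] finD that D by (auto simp: P_def Un_absorb2)
  have disj: "P a \<inter> P b = {}" "P a \<inter> P c = {}" "P a \<inter> P d = {}" "P b \<inter> P c = {}" "P b \<inter> P d = {}"
    "P c \<inter> P d = {}" unfolding P_def using ab ac ad bc bd cd by blast+
  have "card (P a) + card (P b) + card (P c) + card (P d) = card (P a \<union> P b \<union> P c \<union> P d)"
  proof -
    have "finite (P a)" "finite (P b)" "finite (P c)" "finite (P d)" using finP abcd by auto
    moreover have "(P a \<union> P b) \<inter> P c = {}" "(P a \<union> P b \<union> P c) \<inter> P d = {}" using disj by blast+
    ultimately show ?thesis using disj(1) by (metis card_Un_disjoint finite_UnI)
  qed
  also have "\<dots> \<le> card (Y - D)" using N abcd finY by (intro card_mono) (auto simp: P_def)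
  also have "\<dots> = 2" using Y D finD sub(1) N[of a] abcd(1) by (subst card_Diff_subset) auto
  finally have "card (P a) + card (P b) + card (P c) + card (P d) \<le> 2" .
  moreover have "7 \<le> card (N a) + card (N b)" "7 \<le> card (N a) + card (N c)" "7 \<le> card (N a) + card (N d)"
    "7 \<le> card (N b) + card (N c)" "7 \<le> card (N b) + card (N d)" "7 \<le> card (N c) + card (N d)"
    using deg[of a b] deg[of a c] deg[of a d] deg[of b c] deg[of b d] deg[of c d] abcd Y by auto
  moreover have "card (P a) + 3 = card (N a)" "card (P b) + 3 = card (N b)" "card (P c) + 3 = card (N c)"
    "card (P d) + 3 = card (N d)"
    using size sub abcd(1) by auto
  ultimately show False
    by presburger
qed

text \<open>Split \<open>S - {v}\<close> into the neighbours \<open>R\<close> and non-neighbours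
  \<open>M\<close> of a vertex \<open>v\<close>. Without a 4-cycle, \<open>M\<close> is a clique of
  at most three vertices, \<open>R\<close> induces a matching, and a vertex of \<open>M\<close> has
  at most one neighbour in \<open>R\<close>.\<close>

lemma four_cycle_of_seven:
  assumes finS: "finite S" and S7: "7 \<le> card S"
    and sym: "\<And>x y. r x y \<Longrightarrow> r y x"
    and tri: "\<And>x y z. {x, y, z} \<subseteq> S \<Longrightarrow> distinct [x, y, z] \<Longrightarrow> r x y \<or> r y z \<or> r x z"
  shows "\<exists>a b c d. {a, b, c, d} \<subseteq> S \<and> distinct [a, b, c, d] \<and> r a b \<and> r b c \<and> r c d \<and> r d a"
proof (rule ccontr)
  assume no: "\<not> ?thesis"
  have no4: False if "{a, b, c, d} \<subseteq> S" "distinct [a, b, c, d]" "r a b" "r b c" "r c d" "r d a" for a b c d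
    using no that by blast
  obtain v where v: "v \<in> S" using S7 by fastforce
  define R where "R = {y \<in> S. y \<noteq> v \<and> r v y}"
  define M where "M = {y \<in> S. y \<noteq> v \<and> \<not> r v y}"
  have fin: "finite R" "finite M" using finS by (auto simp: R_def M_def)
  have "S - {v} = R \<union> M" "R \<inter> M = {}" by (auto simp: R_def M_def)
  then have RM: "6 \<le> card R + card M"
    using S7 v finS fin card_Un_disjoint[of R M] by (metis card_Diff_singleton diff_le_mono numeral_eq_Suc pred_numeral_simps(3) diff_Suc_1 eval_nat_numeral(3))
  have M: "r x y" if "x \<in> M" "y \<in> M" "x \<noteq> y" for x y
    using tri[of v x y] that v by (auto simp: M_def)
  have MS: "M \<subseteq> S" and RS: "R \<subseteq> S" by (auto simp: M_def R_def)
  have M3: "card M \<le> 3"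
  proof (rule ccontr)
    assume "\<not> card M \<le> 3"
    then have "4 \<le> card M" by simp
    then obtain a b c d where "{a, b, c, d} \<subseteq> M" "distinct [a, b, c, d]" by (rule four_of_card)
    then show False using no4[of a b c d] M MS by auto
  qed
  have path: "\<not> (r x y \<and> r y z)" if "{x, y, z} \<subseteq> R" "distinct [x, y, z]" for x y z
    using no4[of v x y z] that v sym by (auto simp: R_def)
  have out: "x = y" if "x \<in> R" "y \<in> R" "r z x" "r z y" "z \<in> M" for x y z
    using no4[of v x z y] that v sym by (auto simp: R_def M_def)
  consider "card R = 3" | "card R = 4" | "5 \<le> card R" using RM M3 by linarith
  then show False
  proof cases
    case 1
    then have "card M = 3" using RM M3 by linarith
    then obtain z1 z2 z3 where z: "M = {z1, z2, z3}" "distinct [z1, z2, z3]"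
      by (auto simp: card_3_iff)
    obtain xs where xs: "length xs = 3" "distinct xs" "set xs \<subseteq> R"
      using distinct_list_of_card[of 3 R] 1 by auto
    then obtain x y w where xyw: "{x, y, w} \<subseteq> R" "distinct [x, y, w]"
      by (auto simp: numeral_eq_Suc length_Suc_conv)
    then have "r x y \<or> r y w \<or> r x w" using tri RS by (meson order_trans)
    then obtain a b c where abc: "{a, b, c} \<subseteq> R" "distinct [a, b, c]" "r a b"
      using xyw by (metis distinct_length_2_or_more distinct_singleton insert_subset)
    have na: "\<not> r a c" "\<not> r b c" using path[of b a c] path[of a b c] abc sym by auto
    \<comment> \<open>Otherwise \<open>z\<close> would be adjacent to both \<open>a\<close> and
      \<open>b\<close>. So \<open>c\<close> and the triangle \<open>M\<close> contain a
      4-cycle.\<close>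
    have "r z c" if "z \<in> M" for z
    proof (rule ccontr)
      assume n: "\<not> r z c"
      have "z \<notin> R" using that by (auto simp: R_def M_def)
      then have "r z a" "r z b"
        using tri[of a c z] tri[of b c z] na n sym abc that RS MS by auto
      then show False using out[of a b z] abc that by auto
    qed
    then have "r z1 c" "r z2 c" "r z3 c" using z by auto
    moreover have "r z1 z2" "r z2 z3" using M z by auto
    moreover have "c \<notin> M" using abc by (auto simp: M_def R_def)
    ultimately show False using no4[of c z1 z2 z3] z abc sym MS RS by auto
  next
    case 2
    then have "2 \<le> card M" using RM by linarith
    then obtain z where z: "z \<in> M" by fastforce
    have "4 \<le> card R" using 2 by simp
    then obtain w x y u where "{w, x, y, u} \<subseteq> R" and dist: "distinct [w, x, y, u]" by (rule four_of_card)
    then have R: "w \<in> R" "x \<in> R" "y \<in> R" "u \<in> R" by auto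
    have zR: "z \<notin> R" using z by (auto simp: M_def R_def)
    have tr: "r p q \<or> r q s \<or> r p s" if "p \<in> R" "q \<in> R" "s \<in> insert z R" "distinct [p, q, s]" for p q s
      using tri[of p q s] that RS MS z by auto
    have pa: "\<not> (r p q \<and> r q s)" if "p \<in> R" "q \<in> R" "s \<in> R" "distinct [p, q, s]" for p q s
      using path[of p q s] that by auto
    \<comment> \<open>\<open>R\<close> is a perfect matching on four vertices. Since
      \<open>z\<close> sees at most one of them, one end of each edge can be chosen to be
      independent together with \<open>z\<close>.\<close>
    show False
      using tr[of w x y] tr[of w x u] tr[of w y u] tr[of x y u]
        tr[of w x z] tr[of w y z] tr[of w u z] tr[of x y z] tr[of x u z] tr[of y u z]
        pa[of w x y] pa[of w x u] pa[of w y u] pa[of x y u] pa[of x w y] pa[of x w u] pa[of y w u] pa[of y x u]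
        pa[of w y x] pa[of w u x] pa[of w u y] pa[of x u y]
        out[of w x z] out[of w y z] out[of w u z] out[of x y z] out[of x u z] out[of y u z]
        R dist z zR sym by (smt (verit) distinct_length_2_or_more distinct_singleton insert_iff)
  next
    case 3
    obtain xs where xs: "length xs = 5" "distinct xs" "set xs \<subseteq> R"
      using distinct_list_of_card[of 5 R] 3 by auto
    then obtain w x y u t where "xs = [w, x, y, u, t]" by (auto simp: numeral_eq_Suc length_Suc_conv)
    then have R: "w \<in> R" "x \<in> R" "y \<in> R" "u \<in> R" "t \<in> R" and dist: "distinct [w, x, y, u, t]" using xs by auto
    have tr: "r p q \<or> r q s \<or> r p s" if "p \<in> R" "q \<in> R" "s \<in> R" "distinct [p, q, s]" for p q s
      using tri[of p q s] that RS MS by auto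
    have pa: "\<not> (r p q \<and> r q s)" if "p \<in> R" "q \<in> R" "s \<in> R" "distinct [p, q, s]" for p q s
      using path[of p q s] that by auto
    \<comment> \<open>A matching on five vertices leaves an independent triple.\<close>
    show False
      using tr pa R dist sym by (smt (verit) distinct_length_2_or_more distinct_singleton)
  qed
qed

section \<open>Graphs avoiding the tree whose complements avoid the wheel\<close>

lemma card_Int_lower:
  assumes "finite Y"
  shows "card (P \<inter> Y) + card (Q \<inter> Y) \<le> card (Y \<inter> P \<inter> Q) + card Y"
proof -
  have "card (P \<inter> Y) + card (Q \<inter> Y) = card (P \<inter> Y \<union> Q \<inter> Y) + card (P \<inter> Y \<inter> (Q \<inter> Y))"
    using assms by (intro card_Un_Int) auto
  moreover have "card (P \<inter> Y \<union> Q \<inter> Y) \<le> card Y" using assms by (intro card_mono) auto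
  moreover have "P \<inter> Y \<inter> (Q \<inter> Y) = Y \<inter> P \<inter> Q" by auto
  ultimately show ?thesis by simp
qed

lemma card_Int3_lower:
  assumes "finite A" "P \<subseteq> A" "Q \<subseteq> A" "R \<subseteq> A"
  shows "card P + card Q + card R + card (P \<inter> Q \<inter> R)
    \<le> card A + card (P \<inter> Q) + card (Q \<inter> R) + card (P \<inter> R)"
proof -
  have fin: "finite P" "finite Q" "finite R" using assms finite_subset by blast+
  have "card P + card Q = card (P \<union> Q) + card (P \<inter> Q)" using fin by (intro card_Un_Int)
  moreover have "card (P \<union> Q) + card R = card (P \<union> Q \<union> R) + card ((P \<union> Q) \<inter> R)"
    using fin by (intro card_Un_Int) auto
  moreover have "card (P \<inter> R) + card (Q \<inter> R) = card ((P \<inter> R) \<union> (Q \<inter> R)) + card (P \<inter> R \<inter> (Q \<inter> R))"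
    using fin by (intro card_Un_Int) auto
  moreover have "(P \<inter> R) \<union> (Q \<inter> R) = (P \<union> Q) \<inter> R" "P \<inter> R \<inter> (Q \<inter> R) = P \<inter> Q \<inter> R" by auto
  moreover have "card (P \<union> Q \<union> R) \<le> card A" using assms by (intro card_mono) auto
  ultimately show ?thesis by simp
qed

text \<open>The tree is recorded as its pendant path from the centre \<open>v\<close> together with
  a count of the remaining neighbours of \<open>v\<close>, and the wheel as a hub with a list of rim
  vertices, so no embeddings have to be carried along.\<close>

locale tree_wheel_free =
  fixes V :: "'a set" and g :: "'a \<Rightarrow> 'a \<Rightarrow> bool" and n :: nat
  assumes fin: "finite V" and sym: "g x y \<Longrightarrow> g y x" and irr: "\<not> g x x" and n8: "8 \<le> n"
    and order: "n mod 4 \<noteq> 0 \<and> card V = 2 * n - 1 \<or> n mod 4 = 0 \<and> card V = 2 * n"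
    and no_tree: "\<lbrakk>v \<in> V; {p, q, r, s, t} \<subseteq> V; distinct [v, p, q, r, s, t];
        g v p; g p q; g q r; g r s; g s t\<rbrakk> \<Longrightarrow> card ({u \<in> V. g v u} - {p, q, r, s, t}) < n - 6"
    and no_wheel: "\<lbrakk>h \<in> V; set c \<subseteq> {u \<in> V. u \<noteq> h \<and> \<not> g h u}; distinct c; length c = 8;
        \<forall>i<8. \<not> g (c ! i) (c ! (Suc i mod 8))\<rbrakk> \<Longrightarrow> False"
begin

definition nb :: "'a \<Rightarrow> 'a set" where "nb x = {u \<in> V. g x u}"
definition non :: "'a \<Rightarrow> 'a set" where "non x = {u \<in> V. u \<noteq> x \<and> \<not> g x u}"

lemma fin_nb [simp]: "finite (nb x)" and fin_non [simp]: "finite (non x)"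
  using fin by (auto simp: nb_def non_def)

lemma nb_sub: "nb x \<subseteq> V" and non_sub: "non x \<subseteq> V"
  by (auto simp: nb_def non_def)

lemma non_sym: "x \<in> V \<Longrightarrow> y \<in> non x \<Longrightarrow> x \<in> non y"
  using sym by (auto simp: non_def)

lemma card_nb_non_in:
  assumes "Y \<subseteq> V" "x \<notin> Y"
  shows "card (nb x \<inter> Y) + card (non x \<inter> Y) = card Y"
proof -
  have "Y = (nb x \<inter> Y) \<union> (non x \<inter> Y)" "(nb x \<inter> Y) \<inter> (non x \<inter> Y) = {}"
    using assms by (auto simp: nb_def non_def)
  then show ?thesis by (metis card_Un_disjoint fin_nb fin_non finite_Int)
qed

lemma card_nb_non:
  assumes "x \<in> V"
  shows "card (nb x) + card (non x) + 1 = card V"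
proof -
  have "nb x \<inter> (V - {x}) = nb x" "non x \<inter> (V - {x}) = non x"
    using irr by (auto simp: nb_def non_def)
  then have "card (nb x) + card (non x) = card (V - {x})"
    using card_nb_non_in[of "V - {x}" x] by simp
  moreover have "card V > 0" using assms fin card_gt_0_iff by blast
  ultimately show ?thesis using assms fin by simp
qed

section \<open>Wheels in the complement\<close>

lemma wheel8:
  assumes "h \<in> V" "{a, b, c, d, e, f, i, j} \<subseteq> non h" "distinct [a, b, c, d, e, f, i, j]"
    "\<not> g a b" "\<not> g b c" "\<not> g c d" "\<not> g d e" "\<not> g e f" "\<not> g f i" "\<not> g i j" "\<not> g j a"
  shows False
proof (rule no_wheel[of h "[a, b, c, d, e, f, i, j]"])
  show "\<forall>k<8. \<not> g ([a, b, c, d, e, f, i, j] ! k) ([a, b, c, d, e, f, i, j] ! (Suc k mod 8))"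
  proof (intro allI impI)
    fix k :: nat
    assume "k < 8"
    then have "k = 0 \<or> k = 1 \<or> k = 2 \<or> k = 3 \<or> k = 4 \<or> k = 5 \<or> k = 6 \<or> k = 7" by linarith
    then show "\<not> g ([a, b, c, d, e, f, i, j] ! k) ([a, b, c, d, e, f, i, j] ! (Suc k mod 8))"
      using assms(4-11) by (elim disjE) simp_all
  qed
qed (use assms in \<open>auto simp: non_def\<close>)

lemma bip_wheel:
  assumes h: "h \<in> V" and X: "{a, b, c, d} \<subseteq> non h" "distinct [a, b, c, d]"
    and Y: "{p, q, r, s} \<subseteq> non h" "distinct [p, q, r, s]"
    and e: "p \<in> non a \<inter> non b" "q \<in> non b \<inter> non c" "r \<in> non c \<inter> non d" "s \<in> non d \<inter> non a"
    and disj: "{a, b, c, d} \<inter> {p, q, r, s} = {}"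
  shows False
proof (rule wheel8[of h a p b q c r d s])
  show "\<not> g a p" "\<not> g p b" "\<not> g b q" "\<not> g q c" "\<not> g c r" "\<not> g r d" "\<not> g d s" "\<not> g s a"
    using e sym by (auto simp: non_def)
qed (use assms in auto)

text \<open>The rim vertices between \<open>a, b, c, d\<close> are chosen greedily: each must avoid
  at most three earlier ones.\<close>

lemma codeg_wheel:
  assumes h: "h \<in> V" and X: "{a, b, c, d} \<subseteq> non h" "distinct [a, b, c, d]"
    and Y: "Y \<subseteq> non h - {a, b, c, d}"
    and e: "4 \<le> card (Y \<inter> non a \<inter> non b)" "4 \<le> card (Y \<inter> non b \<inter> non c)"
      "4 \<le> card (Y \<inter> non c \<inter> non d)" "4 \<le> card (Y \<inter> non d \<inter> non a)"
  shows False
proof -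
  obtain p where p: "p \<in> Y \<inter> non a \<inter> non b" by (rule card_less_obtain[of "{}" "Y \<inter> non a \<inter> non b"]) (use e(1) in auto)
  obtain q where q: "q \<in> Y \<inter> non b \<inter> non c" "q \<notin> {p}" by (rule card_less_obtain[of "{p}" "Y \<inter> non b \<inter> non c"]) (use e(2) in auto)
  obtain r where r: "r \<in> Y \<inter> non c \<inter> non d" "r \<notin> {p, q}"
    by (rule card_less_obtain[of "{p, q}" "Y \<inter> non c \<inter> non d"]) (use e(3) card_length[of "[p, q]"] in auto)
  obtain s where s: "s \<in> Y \<inter> non d \<inter> non a" "s \<notin> {p, q, r}"
    by (rule card_less_obtain[of "{p, q, r}" "Y \<inter> non d \<inter> non a"]) (use e(4) card_length[of "[p, q, r]"] in auto)
  show False by (rule bip_wheel[OF h X, of p q r s]) (use p q r s Y in auto)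
qed

text \<open>Passing to non-neighbours within \<open>Y\<close> turns \<open>deg\<close> into the
  hypothesis of \<open>alternating_cycle\<close>.\<close>

lemma sparse_wheel:
  assumes h: "h \<in> V" and X: "X \<subseteq> non h" "card X = 4" and Y: "Y \<subseteq> non h" "X \<inter> Y = {}" "5 \<le> card Y"
    and deg: "\<And>x x'. x \<in> X \<Longrightarrow> x' \<in> X \<Longrightarrow> x \<noteq> x' \<Longrightarrow> card (nb x \<inter> Y) + card (nb x' \<inter> Y) + 2 \<le> card Y"
  shows False
proof -
  have YV: "Y \<subseteq> V" using Y non_sub by blast
  have c: "card (nb x \<inter> Y) + card (non x \<inter> Y) = card Y" if "x \<in> X" for x
    using card_nb_non_in[OF YV] that Y by blast
  obtain a b c d p q r s where *: "X = {a, b, c, d}" "distinct [a, b, c, d]" "distinct [p, q, r, s]"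
    "p \<in> (non a \<inter> Y) \<inter> (non b \<inter> Y)" "q \<in> (non b \<inter> Y) \<inter> (non c \<inter> Y)"
    "r \<in> (non c \<inter> Y) \<inter> (non d \<inter> Y)" "s \<in> (non d \<inter> Y) \<inter> (non a \<inter> Y)"
  proof (rule alternating_cycle[of Y X "\<lambda>x. non x \<inter> Y"])
    show "card Y + 2 \<le> card (non x \<inter> Y) + card (non x' \<inter> Y)" if "x \<in> X" "x' \<in> X" "x \<noteq> x'" for x x'
      using deg[OF that] c[OF that(1)] c[OF that(2)] by linarith
  qed (use YV fin finite_subset Y X in auto)
  show False by (rule bip_wheel[OF h, of a b c d p q r s]) (use * X Y in auto)
qed

text \<open>
  Let \<open>A\<close> be the non-neighbourhood of some \<open>h\<close>, let \<open>B\<close> be its complement, and choose \<open>h' \<in> A\<close> with the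
  fewest non-neighbours in \<open>A\<close>. Four non-neighbours of \<open>h'\<close> with few non-neighbours in \<open>A\<close> have many in
  \<open>B\<close>, which gives a wheel with hub \<open>h'\<close>. Otherwise many vertices of \<open>A\<close> have so many non-neighbours in \<open>A\<close>
  that among any three of them two have at least six in common; a 4-cycle of such pairs
  gives a wheel with hub \<open>h\<close>.
\<close>

lemma exists_larger_degree:
  "\<exists>v\<in>V. n < card (nb v) + 6"
proof (rule ccontr)
  assume "\<not> ?thesis"
  then have small: "card (nb v) + 6 \<le> n" if "v \<in> V" for v using that by auto
  define N where "N = card V"
  \<comment> \<open>With all degrees at most \<open>n - 6\<close>, every vertex has at least
    \<open>N - 1 - (n - 6)\<close> non-neighbours.\<close>
  define m where "m = N + 5 - n"
  have N: "2 * n - 1 \<le> N" using order by (auto simp: N_def)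
  have mn: "m + n = N + 5" and mN: "N + 9 \<le> 2 * m" using N n8 by (auto simp: m_def)
  have m: "m \<le> card (non x)" if "x \<in> V" for x
    using small[OF that] card_nb_non[OF that] mn N_def by linarith
  obtain h where h: "h \<in> V" using N n8 N_def by fastforce
  define A where "A = non h"
  define B where "B = V - A"
  have AV: "A \<subseteq> V" and fA: "finite A" and fB: "finite B" using fin by (auto simp: A_def B_def non_def)
  have AB: "card A + card B = N"
    using card_Diff_subset[OF fA AV] card_mono[OF fin AV] by (simp add: B_def N_def)
  have Am: "m \<le> card A" using m h A_def by simp
  define s where "s x = card (non x \<inter> A)" for x
  have sB: "m \<le> s x + card (non x \<inter> B)" if "x \<in> V" for x
  proof -
    have "non x = (non x \<inter> A) \<union> (non x \<inter> B)" using non_sub by (auto simp: B_def)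
    then have "card (non x) = s x + card (non x \<inter> B)"
      unfolding s_def by (metis (no_types, lifting) B_def Diff_disjoint Int_assoc Int_left_commute card_Un_disjoint fin_non finite_Int inf_bot_right)
    then show ?thesis using m[OF that] by simp
  qed
  have "A \<noteq> {}" using Am mn N n8 by auto
  then obtain h' where h': "h' \<in> A" "\<And>x. x \<in> A \<Longrightarrow> s h' \<le> s x"
    using ex_min_if_finite[of "s ` A"] fA by (metis finite_imageI image_iff image_is_empty linorder_not_less)
  have h'V: "h' \<in> V" using h' AV by blast
  define A' where "A' = non h' \<inter> A"
  define B' where "B' = non h' \<inter> B"
  have fB': "finite B'" using fB by (simp add: B'_def)
  have A': "card A' = s h'" by (simp add: A'_def s_def)
  have B': "m \<le> s h' + card B'" using sB[OF h'V] by (simp add: B'_def)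
  have B'B: "card B' \<le> card B" unfolding B'_def using fB by (intro card_mono) auto
  \<comment> \<open>Two vertices \<open>x\<close>, \<open>y\<close> have at least
    \<open>3 * m - s x - s y - s h' - 2 * card B\<close> common non-neighbours in \<open>B'\<close>;
    the threshold makes this at least 4.\<close>
  define Low where "Low = {x \<in> A'. 2 * s x + s h' + 2 * card B + 4 \<le> 3 * m}"
  have Low: "card Low \<le> 3"
  proof (rule ccontr)
    assume "\<not> card Low \<le> 3"
    then have "4 \<le> card Low" by simp
    then obtain a b c d where abcd: "{a, b, c, d} \<subseteq> Low" "distinct [a, b, c, d]" by (rule four_of_card)
    have nB': "m + card B' \<le> s x + card (non x \<inter> B') + card B" if "x \<in> Low" for x
    proof -
      have "x \<in> V" using that by (auto simp: Low_def A'_def A_def non_def)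
      have "card (non x \<inter> B) \<le> card ((non x \<inter> B') \<union> (B - B'))"
        using fB fB' by (intro card_mono) auto
      also have "\<dots> \<le> card (non x \<inter> B') + card (B - B')" by (rule card_Un_le)
      also have "card (B - B') = card B - card B'"
        using fB' by (intro card_Diff_subset) (auto simp: B'_def)
      finally show ?thesis using sB[OF \<open>x \<in> V\<close>] B'B by linarith
    qed
    have "4 \<le> card (B' \<inter> non x \<inter> non y)" if "x \<in> Low" "y \<in> Low" for x y
    proof -
      have "2 * s x + s h' + 2 * card B + 4 \<le> 3 * m" "2 * s y + s h' + 2 * card B + 4 \<le> 3 * m"
        using that by (auto simp: Low_def)
      then show ?thesis
        using card_Int_lower[OF fB', of "non x" "non y"] nB'[OF that(1)] nB'[OF that(2)] B' by linarith
    qed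
    then show False
      using abcd by (intro codeg_wheel[OF h'V, of a b c d B'])
        (auto simp: Low_def A'_def B'_def B_def)
  qed
  \<comment> \<open>Six, because four common non-neighbours must remain after the other two vertices
    of the 4-cycle are removed.\<close>
  define rel where "rel x y \<longleftrightarrow> 6 \<le> card (A \<inter> non x \<inter> non y)" for x y
  have rel_sym: "rel y x" if "rel x y" for x y using that by (simp add: rel_def Int_ac)
  have rel_cycle: False if "{a, b, c, d} \<subseteq> A" "distinct [a, b, c, d]" "rel a b" "rel b c" "rel c d" "rel d a"
    for a b c d
  proof -
    have "4 \<le> card ((A - {a, b, c, d}) \<inter> non x \<inter> non y)"
      if "rel x y" "{a, b, c, d} = {x, y, z, w}" for x y z w
    proof -
      have "6 \<le> card (A \<inter> non x \<inter> non y)" using that by (simp add: rel_def)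
      also have "\<dots> \<le> card ((A - {a, b, c, d}) \<inter> non x \<inter> non y \<union> {z, w})"
        using fA that by (intro card_mono) (auto simp: non_def)
      also have "\<dots> \<le> card ((A - {a, b, c, d}) \<inter> non x \<inter> non y) + card {z, w}" by (rule card_Un_le)
      finally show ?thesis using card_length[of "[z, w]"] by simp
    qed
    note codeg = this
    have "4 \<le> card ((A - {a, b, c, d}) \<inter> non a \<inter> non b)" "4 \<le> card ((A - {a, b, c, d}) \<inter> non b \<inter> non c)"
      "4 \<le> card ((A - {a, b, c, d}) \<inter> non c \<inter> non d)" "4 \<le> card ((A - {a, b, c, d}) \<inter> non d \<inter> non a)"
      using codeg[of a b c d] codeg[of b c d a] codeg[of c d a b] codeg[of d a b c] that(3-6)
      by (auto simp: insert_commute)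
    then show False
      using that(1,2) by (intro codeg_wheel[OF h, of a b c d "A - {a, b, c, d}"]) (auto simp: A_def)
  qed
  \<comment> \<open>If no two of three vertices were related, inclusion-exclusion would bound the
    right-hand side by \<open>card A + 3 * 5\<close>.\<close>
  have seven: False if SA: "S \<subseteq> A" and S7: "7 \<le> card S"
    and S: "\<And>x y z. {x, y, z} \<subseteq> S \<Longrightarrow> distinct [x, y, z] \<Longrightarrow>
      card A + 16 \<le> s x + s y + s z + card ((non x \<inter> A) \<inter> (non y \<inter> A) \<inter> (non z \<inter> A))" for S
  proof -
    have "rel x y \<or> rel y z \<or> rel x z" if xyz: "{x, y, z} \<subseteq> S" "distinct [x, y, z]" for x y z
    proof (rule ccontr)
      assume "\<not> ?thesis"
      then have "card ((non x \<inter> A) \<inter> (non y \<inter> A)) \<le> 5" "card ((non y \<inter> A) \<inter> (non z \<inter> A)) \<le> 5"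
        "card ((non x \<inter> A) \<inter> (non z \<inter> A)) \<le> 5"
        by (simp_all add: rel_def Int_ac)
      then show False
        using S[OF xyz] card_Int3_lower[OF fA Int_lower2 Int_lower2 Int_lower2, of "non x" "non y" "non z"]
        unfolding s_def by linarith
    qed
    then obtain a b c d where "{a, b, c, d} \<subseteq> S" "distinct [a, b, c, d]" "rel a b" "rel b c" "rel c d" "rel d a"
      using four_cycle_of_seven[of S rel, OF finite_subset[OF SA fA] S7 rel_sym] by blast
    then show False using rel_cycle SA by (meson order_trans)
  qed
  define High where "High = A' - Low"
  have "finite Low" using fA by (auto simp: Low_def A'_def)
  then have High: "s h' \<le> card High + 3"
    using Low A' diff_card_le_card_Diff[of Low A'] by (simp add: High_def)
  have HighA: "High \<subseteq> A" by (auto simp: High_def A'_def)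
  have sHigh: "3 * m \<le> 2 * s x + s h' + 2 * card B + 3" if "x \<in> High" for x
    using that by (auto simp: High_def Low_def)
  have triple_bound: "a + 15 \<le> t" if "9 * m \<le> 2 * t + 3 * k + 6 * b + 9" "3 * k \<le> a + 15" "a + b = N" "m \<le> a"
      "N + 9 \<le> 2 * m" for a b t k :: nat
    using that by linarith
  consider "card A + 16 \<le> 3 * s h'" | "3 * s h' \<le> card A + 15" "10 \<le> s h'" | "s h' \<le> 9" by linarith
  then show False
  proof cases
    case 1
    have "card A + 16 \<le> s x + s y + s z" if "{x, y, z} \<subseteq> A" for x y z
      using 1 h'(2)[of x] h'(2)[of y] h'(2)[of z] that by auto
    then show False using seven[of A] Am mn N n8 by fastforce
  next
    case 2
    show False
    proof (rule seven[OF HighA])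
      fix x y z assume xyz: "{x, y, z} \<subseteq> High" "distinct [x, y, z]"
      \<comment> \<open>The estimate for \<open>High\<close> gives only 15 in place of 16; the
        missing unit is \<open>h'\<close>, which lies in every triple intersection.\<close>
      then have "h' \<in> (non x \<inter> A) \<inter> (non y \<inter> A) \<inter> (non z \<inter> A)"
        using h' AV non_sym[OF h'V] by (auto simp: High_def A'_def)
      then have "0 < card ((non x \<inter> A) \<inter> (non y \<inter> A) \<inter> (non z \<inter> A))"
        using fA by (auto simp: card_gt_0_iff)
      moreover have "9 * m \<le> 2 * (s x + s y + s z) + 3 * s h' + 6 * card B + 9"
        using sHigh[of x] sHigh[of y] sHigh[of z] xyz by simp
      moreover from this have "card A + 15 \<le> s x + s y + s z"
        using triple_bound 2(1) AB Am mN by blast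
      ultimately show "card A + 16 \<le> s x + s y + s z + card ((non x \<inter> A) \<inter> (non y \<inter> A) \<inter> (non z \<inter> A))"
        by linarith
    qed (use High 2 in linarith)
  next
    case 3
    have "card B \<le> m - 9" "m \<le> s h' + card B"
      using AB Am mN B' B'B by linarith+
    \<comment> \<open>All estimates are tight here, and \<open>sHigh\<close> becomes
      \<open>m + 6 <= 2 * s x\<close>, so any two vertices of \<open>High\<close> are
      related.\<close>
    then have eq: "card B + 9 = m" "s h' = 9" "card A = m" using 3 AB Am mN by linarith+
    then have "4 \<le> card High" using High by simp
    then obtain a b c d where abcd: "{a, b, c, d} \<subseteq> High" "distinct [a, b, c, d]" by (rule four_of_card)
    have "rel x y" if "x \<in> High" "y \<in> High" for x y
      using sHigh[OF that(1)] sHigh[OF that(2)] card_Int_lower[OF fA, of "non x" "non y"] eq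
      unfolding rel_def s_def by linarith
    then show False using rel_cycle[of a b c d] abcd HighA by auto
  qed
qed

section \<open>Large sets with at most three non-neighbours per vertex\<close>

lemma no_tree_at:
  assumes "v \<in> V" "{p, q, r, s, t} \<subseteq> V" "distinct [v, p, q, r, s, t]"
    "g v p" "g p q" "g q r" "g r s" "g s t" and S: "S \<subseteq> nb v - {p, q, r, s, t}" "n \<le> card S + 6"
  shows False
proof -
  have "card S \<le> card ({u \<in> V. g v u} - {p, q, r, s, t})"
    using S fin by (intro card_mono) (auto simp: nb_def)
  then show False using no_tree[OF assms(1-8)] S(2) by linarith
qed

lemma card_remove3: "card S \<le> card (S - {a, b, c}) + 3" for S :: "'a set"
proof -
  have "card S - card {a, b, c} \<le> card (S - {a, b, c})" by (rule diff_card_le_card_Diff) simp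
  then show ?thesis using card_length[of "[a, b, c]"] by simp
qed

lemma card_remove4: "card S \<le> card (S - {a, b, c, d}) + 4" for S :: "'a set"
proof -
  have "card S - card {a, b, c, d} \<le> card (S - {a, b, c, d})" by (rule diff_card_le_card_Diff) simp
  then show ?thesis using card_length[of "[a, b, c, d]"] by simp
qed

text \<open>The vertex \<open>u\<close> itself is one of the at most three non-neighbours of
  \<open>w\<close>.\<close>

lemma card_non_removed:
  assumes "card (non w \<inter> X) \<le> 3" "u \<in> X" "u \<in> V" "w \<in> non u" "K \<subseteq> X - {u}"
  shows "card (non w \<inter> K) \<le> 2"
proof -
  have "u \<in> non w" using assms non_sym by blast
  have "card (insert u (non w \<inter> K)) \<le> card (non w \<inter> X)"
    using assms(2,5) \<open>u \<in> non w\<close> by (intro card_mono) auto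
  moreover have "card (insert u (non w \<inter> K)) = card (non w \<inter> K) + 1"
    using assms(5) by (subst card_insert_disjoint) auto
  ultimately show ?thesis using assms(1) by linarith
qed

text \<open>This supplies a pendant path through two prescribed vertices at the cost of three
  vertices of \<open>K\<close>; the common neighbour \<open>a\<close> exists since 2 + 2 <
  5.\<close>

lemma path_through:
  assumes K: "K \<subseteq> V" "5 \<le> card K" "w1 \<notin> K" "w2 \<notin> K" "card (non w1 \<inter> K) \<le> 2" "card (non w2 \<inter> K) \<le> 2"
  obtains p a b where "{p, a, b} \<subseteq> K" "distinct [p, a, b]" "g p w1" "g w1 a" "g a w2" "g w2 b"
proof -
  have c: "card (nb w1 \<inter> K) + card (non w1 \<inter> K) = card K" "card (nb w2 \<inter> K) + card (non w2 \<inter> K) = card K"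
    using card_nb_non_in K by auto
  have "finite K" using K(1) fin finite_subset by blast
  have "0 < card (K \<inter> nb w1 \<inter> nb w2)"
    using card_Int_lower[OF \<open>finite K\<close>, of "nb w1" "nb w2"] c K by linarith
  then obtain a where a: "a \<in> K \<inter> nb w1 \<inter> nb w2" by (rule card_pos_obtain)
  obtain p where p: "p \<in> nb w1 \<inter> K" "p \<notin> {a}"
    by (rule card_less_obtain[of "{a}" "nb w1 \<inter> K"]) (use c K in auto)
  obtain b where b: "b \<in> nb w2 \<inter> K" "b \<notin> {a, p}"
    by (rule card_less_obtain[of "{a, p}" "nb w2 \<inter> K"]) (use c K card_length[of "[a, p]"] in auto)
  show thesis by (rule that[of p a b]) (use a p b sym in \<open>auto simp: nb_def\<close>)
qed

text \<open>The aim is to show that such a set \<open>X\<close> is complete multipartite with parts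
  of size four and has exactly \<open>n\<close> vertices.\<close>

context
  fixes X :: "'a set"
  assumes XV: "X \<subseteq> V" and Xn: "n \<le> card X" and X3: "\<And>x. x \<in> X \<Longrightarrow> card (non x \<inter> X) \<le> 3"
begin

lemma card_nb_X: "u \<in> X \<Longrightarrow> card (nb u \<inter> X) + card (non u \<inter> X) + 1 = card X"
proof -
  assume u: "u \<in> X"
  have "nb u \<inter> (X - {u}) = nb u \<inter> X" "non u \<inter> (X - {u}) = non u \<inter> X" using irr by (auto simp: nb_def non_def)
  then have "card (nb u \<inter> X) + card (non u \<inter> X) = card (X - {u})"
    using card_nb_non_in[of "X - {u}" u] XV by auto
  moreover have "card X > 0" using Xn n8 by simp
  ultimately show ?thesis using u by (simp add: card_Diff_singleton)
qed

text \<open>Two non-neighbours of \<open>u\<close> serve as second and fourth vertex of the pendant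
  path, so the path uses only three neighbours of \<open>u\<close>. If the inequality failed, at
  least \<open>n - 6\<close> would be left as leaves.\<close>

lemma card_less_of_two_non: "u \<in> X \<Longrightarrow> 2 \<le> card (non u \<inter> X) \<Longrightarrow> card X + 2 < n + card (non u \<inter> X)"
proof (rule ccontr)
  assume u: "u \<in> X" "2 \<le> card (non u \<inter> X)" and "\<not> card X + 2 < n + card (non u \<inter> X)"
  then have K: "n \<le> card (nb u \<inter> X) + 3" using card_nb_X[OF u(1)] by linarith
  obtain w1 w2 where w: "w1 \<in> non u \<inter> X" "w2 \<in> non u \<inter> X" "w1 \<noteq> w2"
    by (rule two_of_card[OF u(2)])
  have sub: "nb u \<inter> X \<subseteq> X - {u}" using irr by (auto simp: nb_def)
  have le2: "card (non w \<inter> (nb u \<inter> X)) \<le> 2" if "w \<in> non u \<inter> X" for w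
    by (rule card_non_removed[OF X3 u(1) _ _ sub]) (use that XV u(1) in auto)
  obtain p a b where path: "{p, a, b} \<subseteq> nb u \<inter> X" "distinct [p, a, b]" "g p w1" "g w1 a" "g a w2" "g w2 b"
  proof (rule path_through[of "nb u \<inter> X" w1 w2])
    show "nb u \<inter> X \<subseteq> V" using XV by auto
    show "w1 \<notin> nb u \<inter> X" "w2 \<notin> nb u \<inter> X" using w by (auto simp: nb_def non_def)
  qed (use K n8 w le2[OF w(1)] le2[OF w(2)] in auto)
  show False
  proof (rule no_tree_at[of u p w1 a w2 b "nb u \<inter> X - {p, a, b}"])
    show "n \<le> card (nb u \<inter> X - {p, a, b}) + 6" using K card_remove3[of "nb u \<inter> X" p a b] by linarith
  qed (use path w u XV irr in \<open>auto simp: nb_def non_def\<close>)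
qed

text \<open>Otherwise \<open>u\<close> is adjacent to all of \<open>X\<close> except perhaps one
  vertex \<open>w1\<close>. A path \<open>p, w1, a, w2, b\<close> with the other four vertices in
  \<open>K\<close> leaves \<open>n - 6\<close> leaves.\<close>

lemma two_le_card_non: "u \<in> X \<Longrightarrow> 2 \<le> card (non u \<inter> X)"
proof (rule ccontr)
  assume u: "u \<in> X" and "\<not> 2 \<le> card (non u \<inter> X)"
  then have c1: "card (non u \<inter> X) \<le> 1" by simp
  have finX: "finite X" using XV fin finite_subset by blast
  obtain w1 where w1: "w1 \<in> X" "w1 \<noteq> u" "non u \<inter> X \<subseteq> {w1}"
  proof (cases "non u \<inter> X = {}")
    case True
    obtain w where "w \<in> X" "w \<notin> {u}" by (rule card_less_obtain[of "{u}" X]) (use Xn n8 in auto)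
    then show thesis using True that by blast
  next
    case False
    then have "card (non u \<inter> X) = 1" using c1 by (simp add: card_gt_0_iff le_antisym Suc_leI)
    then obtain w where "non u \<inter> X = {w}" by (rule card_1_singletonE)
    then show thesis using that[of w] by (auto simp: non_def)
  qed
  define K where "K = X - {u, w1}"
  have K: "card X = card K + 2"
    using u w1 finX card_Diff_subset[of "{u, w1}" X] card_mono[of X "{u, w1}"] by (simp add: K_def)
  have uK: "g u x" if "x \<in> K" for x using that w1 XV by (auto simp: K_def non_def)
  obtain p a w2 b where path: "{p, a, w2, b} \<subseteq> K" "distinct [p, a, w2, b]" "g p w1" "g w1 a" "g a w2" "g w2 b"
  \<comment> \<open>If \<open>w1\<close> and \<open>w2\<close> are non-adjacent, each uses up a
    non-neighbour of the other and \<open>path_through\<close> applies; otherwise \<open>w1\<close>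
    is adjacent to all of \<open>K\<close> and any \<open>w2\<close> will do.\<close>
  proof (cases "\<exists>w2\<in>K. \<not> g w1 w2")
    case True
    then obtain w2 where w2: "w2 \<in> K" "\<not> g w1 w2" by blast
    have "w1 \<in> non w2" "w2 \<in> non w1" using w2 w1 XV sym by (auto simp: K_def non_def)
    have "finite K" using finX by (simp add: K_def)
    then have "card (K - {w2}) + 1 = card K" using card_Suc_Diff1[OF _ w2(1)] by simp
    then have five: "5 \<le> card (K - {w2})" using K Xn n8 by linarith
    have le1: "card (non w1 \<inter> (K - {w2})) \<le> 2"
      by (rule card_non_removed[OF X3, of _ w2]) (use w1 w2 XV \<open>w1 \<in> non w2\<close> in \<open>auto simp: K_def\<close>)
    have le2: "card (non w2 \<inter> (K - {w2})) \<le> 2"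
      by (rule card_non_removed[OF X3, of _ w1]) (use w1 w2 XV \<open>w2 \<in> non w1\<close> in \<open>auto simp: K_def\<close>)
    obtain p a b where "{p, a, b} \<subseteq> K - {w2}" "distinct [p, a, b]" "g p w1" "g w1 a" "g a w2" "g w2 b"
      by (rule path_through[OF _ five _ _ le1 le2]) (use XV in \<open>auto simp: K_def\<close>)
    then show thesis using that[of p a w2 b] w2 by auto
  next
    case False
    obtain w2 where w2: "w2 \<in> K" by (rule card_pos_obtain[of K]) (use K Xn n8 in auto)
    have "card (non w2 \<inter> (K - {w2})) \<le> card (non w2 \<inter> X)"
      by (intro card_mono) (auto simp: K_def)
    moreover have "card (K - {w2}) + 1 = card K" using card_Suc_Diff1[OF _ w2] finX by (simp add: K_def)
    moreover have "card (non w2 \<inter> X) \<le> 3" using X3 w2 by (simp add: K_def)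
    moreover have "card (nb w2 \<inter> (K - {w2})) + card (non w2 \<inter> (K - {w2})) = card (K - {w2})"
      using XV by (intro card_nb_non_in) (auto simp: K_def)
    ultimately have "2 \<le> card (nb w2 \<inter> (K - {w2}))" using K Xn n8 by linarith
    then obtain a b where ab: "a \<in> nb w2 \<inter> (K - {w2})" "b \<in> nb w2 \<inter> (K - {w2})" "a \<noteq> b"
      by (rule two_of_card)
    obtain p where "p \<in> K" "p \<notin> {a, w2, b}"
      by (rule card_less_obtain[of "{a, w2, b}" K]) (use K Xn n8 card_length[of "[a, w2, b]"] in auto)
    then show thesis using that[of p a w2 b] ab w2 False sym by (auto simp: nb_def)
  qed
  show False
  proof (rule no_tree_at[of u p w1 a w2 b "K - {p, a, w2, b}"])
    show "n \<le> card (K - {p, a, w2, b}) + 6" using K Xn card_remove4[of K p a w2 b] by linarith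
    show "K - {p, a, w2, b} \<subseteq> nb u - {p, w1, a, w2, b}" using uK XV by (auto simp: K_def nb_def)
  qed (use path w1 u XV uK in \<open>auto simp: K_def\<close>)
qed

lemma card_X: "card X = n" and card_non_eq_3: "u \<in> X \<Longrightarrow> card (non u \<inter> X) = 3"
proof -
  obtain v where v: "v \<in> X" by (rule card_pos_obtain[of X]) (use Xn n8 in auto)
  show "card X = n" using card_less_of_two_non[OF v two_le_card_non[OF v]] X3[OF v] Xn by linarith
  then show "card (non u \<inter> X) = 3" if "u \<in> X"
    using card_less_of_two_non[OF that two_le_card_non[OF that]] X3[OF that] by linarith
qed

text \<open>As \<open>u\<close> has only \<open>n - 4\<close> neighbours in \<open>X\<close>, a path
  may use just two of them and must contain all three non-neighbours. An edge among the latter makes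
  this possible.\<close>

lemma non_indep:
  assumes u: "u \<in> X" and w: "w1 \<in> non u \<inter> X" "w2 \<in> non u \<inter> X"
  shows "\<not> g w1 w2"
proof
  assume e: "g w1 w2"
  have "w1 \<noteq> w2" using e irr by blast
  obtain w3 where "w3 \<in> non u \<inter> X" "w3 \<notin> {w1, w2}"
    by (rule card_less_obtain[of "{w1, w2}" "non u \<inter> X"]) (use card_non_eq_3[OF u] card_length[of "[w1, w2]"] in auto)
  note w = w this(1)
  have d: "distinct [w1, w2, w3]" using \<open>w1 \<noteq> w2\<close> \<open>w3 \<notin> {w1, w2}\<close> by auto
  define K where "K = nb u \<inter> X"
  have K: "card K + 4 = n" using card_nb_X[OF u] card_non_eq_3[OF u] card_X by (simp add: K_def)
  have KX: "K \<subseteq> X - {u}" using irr by (auto simp: K_def nb_def)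
  have finK: "finite K" by (simp add: K_def)
  have K2: "card (non x \<inter> K) \<le> 2" if "x \<in> non u \<inter> X" for x
    by (rule card_non_removed[OF X3 u _ _ KX]) (use that XV u in auto)
  have wK: "x \<notin> K" if "x \<in> non u \<inter> X" for x using that by (auto simp: K_def nb_def non_def)
  have nK: "card (nb x \<inter> K) + card (non x \<inter> K) = card K" if "x \<in> non u \<inter> X" for x
    using card_nb_non_in[of K x] wK[OF that] nb_sub by (auto simp: K_def)
  have K1: "card (non x \<inter> K) \<le> 1" if "x \<in> non u \<inter> X" "y \<in> non u \<inter> X" "x \<noteq> y" "\<not> g x y" for x y
  proof -
    have "u \<in> non x" "y \<in> non x" "y \<noteq> u"
      using that u XV sym by (auto simp: non_def)
    then have "card (insert u (insert y (non x \<inter> K))) \<le> card (non x \<inter> X)"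
      using u that KX by (intro card_mono) auto
    moreover have "card (insert u (insert y (non x \<inter> K))) = card (non x \<inter> K) + 2"
      using wK[OF that(2)] KX \<open>y \<noteq> u\<close> finK by (subst card_insert_disjoint, force, force)+ simp
    ultimately show ?thesis using card_non_eq_3[of x] that by simp
  qed
  \<comment> \<open>Being non-adjacent, \<open>y\<close> and \<open>z\<close> each miss at most one
    vertex of \<open>K\<close>, so they have a common neighbour \<open>a\<close>, and the path is
    \<open>p, x, y, a, z\<close>.\<close>
  have main: False if "{x, y, z} \<subseteq> non u \<inter> X" "distinct [x, y, z]" "g x y" "\<not> g z y" for x y z
  proof -
    have "card (non y \<inter> K) \<le> 1" "card (non z \<inter> K) \<le> 1" using K1[of y z] K1[of z y] that sym by auto
    then have "2 \<le> card (K \<inter> nb y \<inter> nb z)"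
      using card_Int_lower[OF finK, of "nb y" "nb z"] nK[of y] nK[of z] that K n8 by auto
    then have "0 < card (K \<inter> nb y \<inter> nb z)" by linarith
    then obtain a where a: "a \<in> K \<inter> nb y \<inter> nb z" by (rule card_pos_obtain)
    have "x \<in> non u \<inter> X" using that by simp
    then have two: "2 \<le> card (nb x \<inter> K)" using nK[of x] K2[of x] K n8 by linarith
    obtain p where p: "p \<in> nb x \<inter> K" "p \<notin> {a}"
      by (rule card_less_obtain[of "{a}" "nb x \<inter> K"]) (use two in auto)
    show False
    proof (rule no_tree_at[of u p x y a z "K - {p, a, a}"])
      show "n \<le> card (K - {p, a, a}) + 6"
        using K diff_card_le_card_Diff[of "{p, a}" K] card_length[of "[p, a]"] by simp
    qed (use a p that u XV sym irr in \<open>auto simp: K_def nb_def non_def\<close>)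
  qed
  show False
  proof (cases "g w3 w2 \<and> g w3 w1")
    case True
    obtain p where p: "p \<in> nb w1 \<inter> K" "p \<notin> {}"
      by (rule card_less_obtain[of "{}" "nb w1 \<inter> K"]) (use nK[OF w(1)] K2[OF w(1)] K n8 in auto)
    obtain b where b: "b \<in> nb w3 \<inter> K" "b \<notin> {p}"
      by (rule card_less_obtain[of "{p}" "nb w3 \<inter> K"]) (use nK[OF w(3)] K2[OF w(3)] K n8 in auto)
    show False
    proof (rule no_tree_at[of u p w1 w2 w3 b "K - {p, b, b}"])
      show "n \<le> card (K - {p, b, b}) + 6"
        using K diff_card_le_card_Diff[of "{p, b}" K] card_length[of "[p, b]"] by simp
    qed (use b p True e w d u XV sym irr in \<open>auto simp: K_def nb_def non_def\<close>)
  next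
    case False
    then show False using main[of w1 w2 w3] main[of w2 w1 w3] w d e sym by auto
  qed
qed

text \<open>By \<open>non_indep\<close>, being equal or non-adjacent is an equivalence relation on
  \<open>X\<close>, and all its classes have four elements.\<close>

lemma four_dvd: "4 dvd n"
proof -
  define r where "r = {(x, y). x \<in> X \<and> y \<in> X \<and> (x = y \<or> \<not> g x y)}"
  have finX: "finite X" using XV fin finite_subset by blast
  have "equiv X r"
  proof (rule equivI)
    show "trans r"
    proof (rule transI)
      fix x y z assume *: "(x, y) \<in> r" "(y, z) \<in> r"
      show "(x, z) \<in> r"
      proof (cases "x = y \<or> y = z \<or> x = z")
        case False
        then have "x \<in> non y \<inter> X" "z \<in> non y \<inter> X" using * XV sym by (auto simp: r_def non_def)
        then show ?thesis using non_indep[of y x z] * by (auto simp: r_def)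
      qed (use * in \<open>auto simp: r_def\<close>)
    qed
  qed (use sym in \<open>auto simp: r_def refl_on_def sym_def\<close>)
  moreover have "4 dvd card C" if C: "C \<in> X // r" for C
  proof -
    obtain x where x: "x \<in> X" "C = r `` {x}" by (rule quotientE[OF C])
    then have "C = insert x (non x \<inter> X)" using XV by (auto simp: r_def non_def)
    moreover have "x \<notin> non x \<inter> X" by (simp add: non_def)
    ultimately have "card C = 4" using card_non_eq_3[OF x(1)] by (simp add: card_insert_disjoint)
    then show ?thesis by simp
  qed
  ultimately show ?thesis using equiv_imp_dvd_card[OF finX] card_X by metis
qed

end

text \<open>A side with \<open>n\<close> vertices forces \<open>4 dvd n\<close>, hence
  \<open>card V = 2 * n\<close>, and then both sides have exactly \<open>n\<close> vertices and
  consist of classes of size four. This graph still has a wheel in its complement.\<close>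

lemma no_edgeless_cut:
  assumes XY: "X \<union> Y = V" "X \<inter> Y = {}" and X4: "4 \<le> card X" and Y4: "4 \<le> card Y"
    and e: "\<And>x y. x \<in> X \<Longrightarrow> y \<in> Y \<Longrightarrow> \<not> g x y"
  shows False
proof -
  have half: "card (non u \<inter> P) \<le> 3"
    if PQ: "P \<union> Q = V" "P \<inter> Q = {}" "4 \<le> card Q" "\<And>x y. x \<in> P \<Longrightarrow> y \<in> Q \<Longrightarrow> \<not> g x y" and u: "u \<in> P" for P Q u
  proof (rule ccontr)
    assume "\<not> ?thesis"
    then have "4 \<le> card (non u \<inter> P)" by simp
    then obtain a b c d where abcd: "{a, b, c, d} \<subseteq> non u \<inter> P" "distinct [a, b, c, d]" by (rule four_of_card)
    have "Q \<subseteq> non x" if "x \<in> P" for x using that PQ by (auto simp: non_def)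
    then have "Q \<inter> non x \<inter> non y = Q" if "x \<in> P" "y \<in> P" for x y using that by blast
    then show False
      using abcd u PQ \<open>\<And>x. x \<in> P \<Longrightarrow> Q \<subseteq> non x\<close>
      by (intro codeg_wheel[of u a b c d Q]) auto
  qed
  have X3: "card (non u \<inter> X) \<le> 3" if "u \<in> X" for u using half[OF XY Y4 e that] .
  have Y3: "card (non u \<inter> Y) \<le> 3" if "u \<in> Y" for u
    by (rule half[of Y X]) (use XY X4 e sym that in blast)+
  have V: "card X + card Y = card V"
    using XY fin card_Un_disjoint[of X Y] by (metis finite_Un)
  have XV: "X \<subseteq> V" and YV: "Y \<subseteq> V" using XY by auto
  have "n \<le> card X \<or> n \<le> card Y" using V order n8 by linarith
  then have "4 dvd n" using four_dvd[OF XV _ X3] four_dvd[OF YV _ Y3] by blast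
  then have "card V = 2 * n" using order by auto
  then have n: "n \<le> card X" "n \<le> card Y"
    using card_X[OF XV _ X3] card_X[OF YV _ Y3] V by linarith+
  obtain u where u: "u \<in> X" by (rule card_pos_obtain[of X]) (use X4 in auto)
  obtain y where y: "y \<in> Y" by (rule card_pos_obtain[of Y]) (use Y4 in auto)
  obtain x1 x2 x3 where x: "non u \<inter> X = {x1, x2, x3}" "distinct [x1, x2, x3]"
    using card_non_eq_3[OF XV n(1) X3 u] by (auto simp: card_3_iff)
  obtain y1 y2 y3 where ys: "non y \<inter> Y = {y1, y2, y3}" "distinct [y1, y2, y3]"
    using card_non_eq_3[OF YV n(2) Y3 y] by (auto simp: card_3_iff)
  have yn: "y1 \<in> non y \<inter> Y" "y2 \<in> non y \<inter> Y" "y3 \<in> non y \<inter> Y" using ys by auto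
  have y12: "\<not> g y1 y2" using non_indep[OF YV n(2) Y3 y] yn by blast
  obtain z where z: "z \<in> Y" "z \<notin> {y, y1, y2, y3}"
    by (rule card_less_obtain[of "{y, y1, y2, y3}" Y]) (use n n8 card_length[of "[y, y1, y2, y3]"] in auto)
  have xn: "x1 \<in> non u \<inter> X" "x2 \<in> non u \<inter> X" "x3 \<in> non u \<inter> X" using x by auto
  show False
  \<comment> \<open>Only three non-neighbours of \<open>u\<close> lie in \<open>X\<close>, so the
    rim takes five vertices of \<open>Y\<close>; the consecutive pairs \<open>y1, y2\<close> and
    \<open>y3, y\<close> are taken inside one class.\<close>
  proof (rule wheel8[of u x1 y1 y2 x2 y3 y x3 z])
    show "\<not> g x1 y1" "\<not> g y2 x2" "\<not> g x2 y3" "\<not> g y x3" "\<not> g x3 z" "\<not> g z x1"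
      using e xn yn y z sym by blast+
    show "\<not> g y3 y" using yn sym by (auto simp: non_def)
    have "Y \<subseteq> non u" using u e XY by (auto simp: non_def)
    then show "{x1, y1, y2, x2, y3, y, x3, z} \<subseteq> non u" using xn yn y z by blast
    have "x1 \<notin> Y" "x2 \<notin> Y" "x3 \<notin> Y" using xn XY(2) by blast+
    moreover have "y1 \<in> Y" "y2 \<in> Y" "y3 \<in> Y" using yn by blast+
    moreover have "y \<noteq> y1" "y \<noteq> y2" "y \<noteq> y3" using yn by (auto simp: non_def)
    ultimately show "distinct [x1, y1, y2, x2, y3, y, x3, z]"
      using x(2) ys(2) y z by auto
  qed (use u XV y12 in auto)
qed

section \<open>Forbidden paths and vertices of high degree\<close>

text \<open>A path from \<open>w\<close> stops after at most three vertices \<open>w, x, z\<close>,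
  so \<open>z\<close> sees only \<open>w\<close> and \<open>x\<close>. If it sees \<open>w\<close>,
  the path \<open>w, z, x\<close> bounds the neighbours of \<open>x\<close> as well.\<close>

lemma sparse_of_no_P4:
  assumes Z: "Z \<subseteq> V" "w \<in> Z"
    and P4: "\<And>x y z. {x, y, z} \<subseteq> Z \<Longrightarrow> distinct [w, x, y, z] \<Longrightarrow> g w x \<Longrightarrow> g x y \<Longrightarrow> g y z \<Longrightarrow> False"
  obtains z where "z \<in> Z" "card (nb z \<inter> Z) \<le> 1"
  | x z where "x \<in> Z" "z \<in> Z" "x \<noteq> z" "nb z \<inter> Z \<subseteq> {w, x}" "nb x \<inter> Z \<subseteq> {w, z}"
proof (cases "\<exists>x\<in>Z. g w x")
  case False
  then have "nb w \<inter> Z = {}" by (auto simp: nb_def)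
  then show thesis using that(1)[of w] Z by simp
next
  case True
  then obtain x where x: "x \<in> Z" "g w x" by blast
  then have "x \<noteq> w" using irr by blast
  show thesis
  proof (cases "\<exists>z\<in>Z. g x z \<and> z \<noteq> w")
    case False
    then have "nb x \<inter> Z \<subseteq> {w}" by (auto simp: nb_def)
    then have "card (nb x \<inter> Z) \<le> 1" using card_mono[of "{w}"] by fastforce
    then show thesis using that(1) x by blast
  next
    case True
    then obtain z where z: "z \<in> Z" "g x z" "z \<noteq> w" by blast
    then have "z \<noteq> x" using irr by blast
    have nz: "nb z \<inter> Z \<subseteq> {w, x}"
      using P4[of x z] x z \<open>x \<noteq> w\<close> \<open>z \<noteq> x\<close> irr by (fastforce simp: nb_def)
    show thesis
    proof (cases "g z w")
      case True
      then have "nb x \<inter> Z \<subseteq> {w, z}"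
        using P4[of z x] x z \<open>x \<noteq> w\<close> \<open>z \<noteq> x\<close> irr sym by (fastforce simp: nb_def)
      then show thesis using that(2) x z nz \<open>z \<noteq> x\<close> by blast
    next
      case False
      then have "nb z \<inter> Z \<subseteq> {x}" using nz by (auto simp: nb_def)
      then have "card (nb z \<inter> Z) \<le> 1" using card_mono[of "{x}"] by fastforce
      then show thesis using that(1) z by blast
    qed
  qed
qed

text \<open>A path from \<open>w\<close> that cannot be extended has at most four vertices, and its
  last vertex sees only the earlier ones.\<close>

lemma sparse_of_no_P5:
  assumes Z: "Z \<subseteq> V" "w \<in> Z"
    and P5: "\<And>x y z t. {x, y, z, t} \<subseteq> Z \<Longrightarrow> distinct [w, x, y, z, t] \<Longrightarrow>
      g w x \<Longrightarrow> g x y \<Longrightarrow> g y z \<Longrightarrow> g z t \<Longrightarrow> False"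
  obtains z where "z \<in> Z" "card (nb z \<inter> Z) \<le> 3"
proof -
  note found = that
  have ends: thesis if "z \<in> Z" "nb z \<inter> Z \<subseteq> set xs" "length xs \<le> 3" for z xs
    using that card_mono[of "set xs" "nb z \<inter> Z"] card_length[of xs] by (intro found[of z]) auto
  show thesis
  proof (cases "\<exists>x\<in>Z. g w x")
    case False
    then show thesis using ends[of w "[]"] Z by (auto simp: nb_def)
  next
    case True
    then obtain x where x: "x \<in> Z" "g w x" by blast
    then have "x \<noteq> w" using irr by blast
    show thesis
    proof (cases "\<exists>y\<in>Z. g x y \<and> y \<noteq> w")
      case False
      then show thesis using ends[of x "[w]"] x by (auto simp: nb_def)
    next
      case True
      then obtain y where y: "y \<in> Z" "g x y" "y \<noteq> w" by blast
      then have "y \<noteq> x" using irr by blast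
      show thesis
      proof (cases "\<exists>z\<in>Z. g y z \<and> z \<noteq> w \<and> z \<noteq> x")
        case False
        then show thesis using ends[of y "[w, x]"] y by (auto simp: nb_def)
      next
        case True
        then obtain z where z: "z \<in> Z" "g y z" "z \<noteq> w" "z \<noteq> x" by blast
        then have "z \<noteq> y" using irr by blast
        have "nb z \<inter> Z \<subseteq> {w, x, y}"
          using P5[of x y z] x y z \<open>x \<noteq> w\<close> \<open>y \<noteq> x\<close> \<open>z \<noteq> y\<close> irr by (fastforce simp: nb_def)
        then show thesis using ends[of z "[w, x, y]"] z by auto
      qed
    qed
  qed
qed

text \<open>
  Four vertices that are sparse at their removal serve as one class of an alternating \<open>C\<^sub>8\<close>. With only nine
  vertices available, at most one of them may have two neighbours left, so the two vertices of
  a pendant triangle are removed together when possible.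
\<close>

lemma no_four_bad:
  assumes h: "h \<in> V" and U: "U \<subseteq> non h" "9 \<le> card U" and W: "W \<subseteq> U" "4 \<le> card W"
    and P4: "\<And>w x y z. w \<in> W \<Longrightarrow> {x, y, z} \<subseteq> U \<Longrightarrow> distinct [w, x, y, z] \<Longrightarrow>
      g w x \<Longrightarrow> g x y \<Longrightarrow> g y z \<Longrightarrow> False"
  shows False
proof -
  have UV: "U \<subseteq> V" using U non_sub by blast
  have finU: "finite U" using UV fin finite_subset by blast
  define I where "I X \<longleftrightarrow> X \<subseteq> U \<and> (\<forall>x\<in>X. card (nb x \<inter> (U - X)) \<le> 1)" for X
  have finI: "finite X" if "I X" for X using that finU finite_subset by (auto simp: I_def)
  have mono: "card (nb x \<inter> (U - X')) \<le> card (nb x \<inter> (U - X))" if "X \<subseteq> X'" for x X X'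
    using that by (intro card_mono) auto
  have step: "(\<exists>z\<in>U - X. I (insert z X)) \<or>
      (\<exists>x\<in>U - X. \<exists>z\<in>U - X. x \<noteq> z \<and> I (insert x (insert z X)) \<and> card (nb z \<inter> (U - X)) \<le> 2)"
    if X: "I X" "card X < 4" for X
  proof -
    obtain w where w: "w \<in> W" "w \<notin> X"
      by (rule card_less_obtain[of X W]) (use X W finI in auto)
    have "w \<in> U - X" using w W by blast
    have XU: "X \<subseteq> U" using X by (simp add: I_def)
    show ?thesis
    proof (rule sparse_of_no_P4[of "U - X" w])
      fix z assume z: "z \<in> U - X" "card (nb z \<inter> (U - X)) \<le> 1"
      have "I (insert z X)"
        unfolding I_def using X z XU mono[of X "insert z X"] by (auto simp: I_def intro: order_trans)
      then show ?thesis using z by blast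
    next
      fix x z assume xz: "x \<in> U - X" "z \<in> U - X" "x \<noteq> z" "nb z \<inter> (U - X) \<subseteq> {w, x}" "nb x \<inter> (U - X) \<subseteq> {w, z}"
      let ?X = "insert x (insert z X)"
      have "nb z \<inter> (U - ?X) \<subseteq> {w}" "nb x \<inter> (U - ?X) \<subseteq> {w}" using xz by blast+
      then have "card (nb z \<inter> (U - ?X)) \<le> 1" "card (nb x \<inter> (U - ?X)) \<le> 1"
        using card_mono[of "{w}"] by fastforce+
      then have "I ?X"
        unfolding I_def using X xz XU mono[of X ?X] by (auto simp: I_def intro: le_trans[OF mono[of X ?X]])
      moreover have "card (nb z \<inter> (U - X)) \<le> 2"
        using card_mono[OF _ xz(4)] card_length[of "[w, x]"] by simp
      ultimately show ?thesis using xz by blast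
    next
      show False if "{x, y, z} \<subseteq> U - X" "distinct [w, x, y, z]" "g w x" "g x y" "g y z" for x y z
        using P4[OF w(1), of x y z] that by blast
    qed (use UV \<open>w \<in> U - X\<close> in auto)
  qed
  have ins: "card (insert z X) = card X + 1" if "I X" "z \<in> U - X" for z X
    using that finI by simp
  have ins2: "card (insert x (insert z X)) = card X + 2" if "I X" "z \<in> U - X" "x \<in> U - X" "x \<noteq> z" for x z X
    using that finI by simp
  \<comment> \<open>A step may add two vertices at once, so a prescribed size can be overshot by
    one.\<close>
  have "\<exists>X. I X \<and> (card X = k \<or> card X = k + 1)" if "k \<le> 3" for k
    using that
  proof (induction k)
    case 0
    then show ?case by (intro exI[of _ "{}"]) (simp add: I_def)
  next
    case (Suc k)
    then obtain X where X: "I X" "card X = k \<or> card X = k + 1" by auto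
    show ?case
    proof (cases "card X = k")
      case True
      then have "card X < 4" using Suc.prems by simp
      from step[OF X(1) this] show ?thesis
      proof (elim disjE bexE conjE)
        fix z assume z: "z \<in> U - X" "I (insert z X)"
        then show ?thesis using ins[OF X(1) z(1)] True by (intro exI[of _ "insert z X"]) simp
      next
        fix x z assume z: "x \<in> U - X" "z \<in> U - X" "x \<noteq> z" "I (insert x (insert z X))"
        then show ?thesis using ins2[OF X(1) z(2,1,3)] True
          by (intro exI[of _ "insert x (insert z X)"]) simp
      qed
    qed (use X in auto)
  qed
  from this[of 3] obtain X where X: "I X" "card X = 3 \<or> card X = 4" by auto
  \<comment> \<open>One exceptional vertex \<open>v\<close> with two remaining neighbours is
    tolerated, since 1 + 2 + 2 <= 5.\<close>
  have wheel: False if X4: "X' \<subseteq> U" "card X' = 4" and v: "v \<in> X'"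
    and n1: "\<And>x. x \<in> X' \<Longrightarrow> x \<noteq> v \<Longrightarrow> card (nb x \<inter> (U - X')) \<le> 1" and n2: "card (nb v \<inter> (U - X')) \<le> 2" for X' v
  proof (rule sparse_wheel[OF h, of X' "U - X'"])
    have "card (U - X') + 4 = card U"
      using X4 finU card_Diff_subset[of X' U] card_mono[of U X'] finite_subset[of X' U] by auto
    then have Y5: "5 \<le> card (U - X')" using U(2) by simp
    then show "5 \<le> card (U - X')" .
    show "card (nb x \<inter> (U - X')) + card (nb x' \<inter> (U - X')) + 2 \<le> card (U - X')"
      if "x \<in> X'" "x' \<in> X'" "x \<noteq> x'" for x x'
    proof (cases "x = v")
      case True
      then show ?thesis using n1[of x'] n2 that Y5 by force
    next
      case False
      then have "card (nb x' \<inter> (U - X')) \<le> 2" using n1[of x'] n2 that by (cases "x' = v") force+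
      then show ?thesis using n1[of x] that Y5 False by force
    qed
  qed (use X4 U in auto)
  show False
  proof (cases "card X = 4")
    case True
    then obtain v where "v \<in> X" by fastforce
    then show False using wheel[of X v] X True by (fastforce simp: I_def)
  next
    case False
    then have X3: "card X = 3" using X by simp
    then have "card X < 4" by simp
    from step[OF X(1) this] show False
    proof (elim disjE bexE conjE)
      fix z assume z: "z \<in> U - X" "I (insert z X)"
      show False by (rule wheel[of "insert z X" z])
        (use z ins[OF X(1) z(1)] X3 in \<open>fastforce simp: I_def\<close>)+
    next
      fix x z assume z: "x \<in> U - X" "z \<in> U - X" "card (nb z \<inter> (U - X)) \<le> 2"
      \<comment> \<open>Adding both vertices would give five, so only \<open>z\<close> is added, as
        the exceptional vertex.\<close>
      show False
      proof (rule wheel[of "insert z X" z])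
        show "card (nb z \<inter> (U - insert z X)) \<le> 2" using mono[of X "insert z X" z] z by force
        show "card (nb x \<inter> (U - insert z X)) \<le> 1" if "x \<in> insert z X" "x \<noteq> z" for x
          using mono[of X "insert z X" x] that X by (force simp: I_def)
      qed (use z ins[OF X(1) z(2)] X X3 in \<open>auto simp: I_def\<close>)
    qed
  qed
qed

lemma medium_degree:
  assumes v: "v \<in> V" and deg: "n \<le> card (nb v) + 5" and U9: "9 \<le> card (non v)"
  shows False
proof -
  define W where "W = {u \<in> non v. \<exists>a\<in>nb v. g a u}"
  \<comment> \<open>The pendant path would be \<open>a, w, x, y, z\<close>; only \<open>a\<close> is
    a neighbour of \<open>v\<close>, so at least \<open>n - 6\<close> leaves remain.\<close>
  have P4: False if w: "w \<in> W" and xyz: "{x, y, z} \<subseteq> non v" and d: "distinct [w, x, y, z]"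
    and e: "g w x" "g x y" "g y z" for w x y z
  proof -
    obtain a where a: "a \<in> nb v" "g a w" and w': "w \<in> non v" using w by (auto simp: W_def)
    have "card (nb v - {a}) + 1 = card (nb v)" using card_Suc_Diff1[OF _ a(1)] by simp
    then show False
      using a w' xyz d e v deg irr by (intro no_tree_at[of v a w x y z "nb v - {a}"]) (auto simp: nb_def non_def)
  qed
  have W3: "card W \<le> 3"
  proof (rule ccontr)
    assume "\<not> card W \<le> 3"
    then show False using no_four_bad[OF v _ U9, of W] P4 by (auto simp: W_def)
  qed
  define U where "U = non v - W"
  have "finite W" by (simp add: W_def)
  then have U6: "6 \<le> card U" using diff_card_le_card_Diff[of W "non v"] U9 W3 by (simp add: U_def)
  have UV: "U \<subseteq> V" using non_sub by (auto simp: U_def)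
  have nA: "\<not> g a u" if "a \<in> insert v (nb v)" "u \<in> U" for a u
    using that by (auto simp: U_def W_def non_def)
  have A4: "4 \<le> card (insert v (nb v))"
  proof -
    have "v \<notin> nb v" using irr by (simp add: nb_def)
    then show ?thesis using deg n8 by simp
  qed
  \<comment> \<open>Otherwise four non-neighbours of \<open>u\<close> in \<open>U\<close> alternate
    with vertices of \<open>insert v (nb v)\<close>, which has no edges to \<open>U\<close>.\<close>
  have U3: "card (non u \<inter> U) \<le> 3" if u: "u \<in> U" for u
  proof (rule ccontr)
    assume "\<not> ?thesis"
    then have "4 \<le> card (non u \<inter> U)" by simp
    then obtain a b c d where abcd: "{a, b, c, d} \<subseteq> non u \<inter> U" "distinct [a, b, c, d]" by (rule four_of_card)
    have sub: "insert v (nb v) \<subseteq> non x" if "x \<in> U" for x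
      using nA[OF _ that] v sym that by (fastforce simp: non_def nb_def U_def)
    then have "insert v (nb v) \<inter> non x \<inter> non y = insert v (nb v)" if "x \<in> U" "y \<in> U" for x y
      using that by blast
    moreover have "insert v (nb v) \<inter> U = {}" by (auto simp: U_def non_def nb_def)
    then have "insert v (nb v) \<subseteq> non u - {a, b, c, d}" using sub[OF u] abcd by blast
    ultimately show False
      using abcd u UV A4 by (intro codeg_wheel[of u a b c d "insert v (nb v)"]) auto
  qed
  have nbU: "2 \<le> card (nb u \<inter> U)" if u: "u \<in> U" for u
  proof -
    have "nb u \<inter> (U - {u}) = nb u \<inter> U" "non u \<inter> (U - {u}) = non u \<inter> U" using irr by (auto simp: nb_def non_def)
    then have "card (nb u \<inter> U) + card (non u \<inter> U) = card (U - {u})"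
      using card_nb_non_in[of "U - {u}" u] UV by auto
    moreover have "card (U - {u}) + 1 = card U"
      using card_Suc_Diff1[OF _ u] UV fin finite_subset by fastforce
    ultimately show ?thesis using U3[OF u] U6 by linarith
  qed
  \<comment> \<open>Minimum degree two inside \<open>U\<close> would extend such an edge to a path
    on four vertices starting in \<open>W\<close>.\<close>
  have nW: "\<not> g w u" if w: "w \<in> W" and u: "u \<in> U" for w u
  proof
    assume e: "g w u"
    obtain x where x: "x \<in> nb u \<inter> U" by (rule card_pos_obtain[of "nb u \<inter> U"]) (use nbU[OF u] in auto)
    then have x2: "2 \<le> card (nb x \<inter> U)" using nbU by blast
    obtain y where y: "y \<in> nb x \<inter> U" "y \<notin> {u}" by (rule card_less_obtain[of "{u}" "nb x \<inter> U"]) (use x2 in auto)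
    show False
      by (rule P4[OF w, of u x y]) (use x y u w e irr in \<open>auto simp: U_def nb_def\<close>)
  qed
  show False
  proof (rule no_edgeless_cut[of "V - U" U])
    have "insert v (nb v) \<subseteq> V - U" using v nb_sub by (auto simp: U_def non_def nb_def)
    then show "4 \<le> card (V - U)" using A4 fin by (meson card_mono finite_Diff le_trans)
    show "\<not> g x y" if "x \<in> V - U" "y \<in> U" for x y
    proof (cases "x \<in> insert v (nb v)")
      case False
      then have "x \<in> W" using that by (auto simp: U_def non_def nb_def)
      then show ?thesis using nW that by blast
    qed (use nA that in blast)
  qed (use UV U6 in auto)
qed

lemma large_degree:
  assumes v: "v \<in> V" and U8: "card (non v) \<le> 8"
  shows False
proof -
  define V' where "V' = V - {v}"
  define A where "A = nb v"
  have V': "card V' + 1 = card V" using card_Suc_Diff1[OF fin v] by (simp add: V'_def)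
  have V'V: "V' \<subseteq> V" and AV': "A \<subseteq> V'" using irr by (auto simp: V'_def A_def nb_def)
  have A: "card V \<le> card A + 9" using card_nb_non[OF v] U8 by (simp add: A_def)
  have P5: False if w: "w \<in> A" and Z: "{x, y, z, t} \<subseteq> V'" and d: "distinct [w, x, y, z, t]"
    and e: "g w x" "g x y" "g y z" "g z t" for w x y z t
  proof (rule no_tree_at[of v w x y z t "A - {w} - {x, y, z, t}"])
    have "card (A - {w}) + 1 = card A" using card_Suc_Diff1[OF _ w] by (simp add: A_def)
    \<comment> \<open>At least \<open>card V - 14\<close> leaves remain. This is tight for
      \<open>n = 8\<close>, where \<open>card V = 16\<close>, and for \<open>n = 9\<close>, where
      \<open>card V = 17\<close>.\<close>
    then show "n \<le> card (A - {w} - {x, y, z, t}) + 6"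
      using card_remove4[of "A - {w}" x y z t] A order n8 by presburger
  qed (use w Z d e v V'V irr in \<open>auto simp: A_def nb_def V'_def\<close>)
  have low: "\<exists>z\<in>Z. card (nb z \<inter> Z) \<le> 3" if Z: "Z \<subseteq> V'" and w: "w \<in> Z \<inter> A" for Z w
  proof (rule sparse_of_no_P5[of Z w])
    show False if "{x, y, z, t} \<subseteq> Z" "distinct [w, x, y, z, t]" "g w x" "g x y" "g y z" "g z t" for x y z t
      using P5[of w x y z t] that Z w by blast
  qed (use Z w V'V in auto)
  have A7: "7 \<le> card A" using A order n8 by presburger
  obtain w where "w \<in> A" by (rule card_pos_obtain[of A]) (use A7 in auto)
  then obtain x1 where x1: "x1 \<in> V'" "card (nb x1 \<inter> V') \<le> 3" using low[of V' w] AV' by auto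
  have x1V: "x1 \<in> V" using x1 V'V by blast
  have "card (nb x1) \<le> card (insert v (nb x1 \<inter> V'))"
    using nb_sub by (intro card_mono) (auto simp: V'_def)
  also have "\<dots> \<le> card (nb x1 \<inter> V') + 1" by (simp add: card_insert_if)
  finally have "card (nb x1) \<le> 4" using x1 by simp
  then have "9 \<le> card (non x1)" using card_nb_non[OF x1V] order n8 by auto
  \<comment> \<open>For \<open>n = 8\<close> this improves the degree bound of \<open>x1\<close> to
    2, as required for the size of \<open>R\<close>.\<close>
  then have "card (nb x1) + 6 \<le> n" using medium_degree[OF x1V] by force
  define R where "R = V' - insert x1 (nb x1)"
  have Rnon: "R \<subseteq> non x1" by (auto simp: R_def V'_def non_def nb_def)
  have RV': "R \<subseteq> V'" by (auto simp: R_def)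
  have ins: "card (insert x1 (nb x1 \<inter> V')) \<le> card (nb x1 \<inter> V') + 1" by (simp add: card_insert_if)
  have "card V' \<le> card (R \<union> insert x1 (nb x1 \<inter> V'))"
    using V'V fin finite_subset by (intro card_mono) (auto simp: R_def)
  also have "\<dots> \<le> card R + card (insert x1 (nb x1 \<inter> V'))" by (rule card_Un_le)
  finally have R: "card V' \<le> card R + (card (nb x1 \<inter> V') + 1)" using ins by simp
  have "card A \<le> card ((R \<inter> A) \<union> insert x1 (nb x1 \<inter> V'))"
    using V'V fin finite_subset AV' by (intro card_mono) (auto simp: R_def)
  also have "\<dots> \<le> card (R \<inter> A) + card (insert x1 (nb x1 \<inter> V'))" by (rule card_Un_le)
  finally have RA: "card A \<le> card (R \<inter> A) + (card (nb x1 \<inter> V') + 1)" using ins by simp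
  have d: "card (nb x1 \<inter> V') \<le> card (nb x1)" by (intro card_mono) auto
  have R12: "12 \<le> card R" and RA4: "4 \<le> card (R \<inter> A)"
  proof -
    consider "n = 8" "card V = 16" | "17 \<le> card V" using order n8 by (cases "n = 8") auto
    then have "card (nb x1 \<inter> V') + 14 \<le> card V"
      by cases (use x1(2) d \<open>card (nb x1) + 6 \<le> n\<close> in linarith)+
    then show "12 \<le> card R" "4 \<le> card (R \<inter> A)" using R RA V' A by linarith+
  qed
  have finR: "finite R" by (rule finite_subset[OF order_trans[OF RV' V'V] fin])
  \<comment> \<open>Low-degree vertices are peeled off one at a time; \<open>R - X\<close> still
    meets \<open>A\<close> at each stage because
    \<open>card X < 4 <= card (R \<inter> A)\<close>.\<close>
  have "\<exists>X\<subseteq>R. card X = k \<and> (\<forall>x\<in>X. card (nb x \<inter> (R - X)) \<le> 3)" if "k \<le> 4" for k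
    using that
  proof (induction k)
    case 0
    then show ?case by (intro exI[of _ "{}"]) simp
  next
    case (Suc k)
    then obtain X where X: "X \<subseteq> R" "card X = k" "\<forall>x\<in>X. card (nb x \<inter> (R - X)) \<le> 3" by auto
    have finX: "finite X" using X finR finite_subset by blast
    obtain w where w: "w \<in> R \<inter> A" "w \<notin> X"
      by (rule card_less_obtain[OF finX, of "R \<inter> A"]) (use X RA4 Suc.prems in auto)
    obtain z where z: "z \<in> R - X" "card (nb z \<inter> (R - X)) \<le> 3"
      using low[of "R - X" w] RV' w by auto
    have "card (nb x \<inter> (R - insert z X)) \<le> 3" if "x \<in> insert z X" for x
    proof -
      have "card (nb x \<inter> (R - insert z X)) \<le> card (nb x \<inter> (R - X))" by (intro card_mono) auto
      also have "\<dots> \<le> 3" using that X z by auto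
      finally show ?thesis .
    qed
    then show ?case using X z finX by (intro exI[of _ "insert z X"]) auto
  qed
  from this[of 4] obtain X where X: "X \<subseteq> R" "card X = 4" "\<forall>x\<in>X. card (nb x \<inter> (R - X)) \<le> 3" by auto
  have "card R \<le> card (R - X) + 4"
    using diff_card_le_card_Diff[of X R] X finR finite_subset by fastforce
  then have Y8: "8 \<le> card (R - X)" using R12 by linarith
  show False
  \<comment> \<open>The eight vertices left are just enough: 3 + 3 + 2 = 8.\<close>
  proof (rule sparse_wheel[OF x1V, of X "R - X"])
    show "card (nb x \<inter> (R - X)) + card (nb x' \<inter> (R - X)) + 2 \<le> card (R - X)" if "x \<in> X" "x' \<in> X" "x \<noteq> x'" for x x'
      using X(3)[rule_format, OF that(1)] X(3)[rule_format, OF that(2)] Y8 by linarith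
  qed (use X Rnon Y8 in auto)
qed

lemma contradiction: False
proof -
  obtain v where "v \<in> V" "n < card (nb v) + 6" using exists_larger_degree by blast
  then show False using medium_degree[of v] large_degree[of v] by linarith
qed

end

section \<open>The Ramsey number\<close>

lemma pair_graph_complement:
  assumes "pair_graph F"
  shows "pair_graph (complement F)"
proof -
  interpret F: pair_graph F by fact
  have "parcs (complement F) \<subseteq> pverts F \<times> pverts F" by (auto simp: complement_def)
  then have "finite (parcs (complement F))" by (rule finite_subset) simp
  moreover have "sym (parcs (complement F))"
    by (rule symI) (auto simp: complement_def dest: F.arcs_symmetric)
  ultimately show ?thesis
    by unfold_locales (auto simp: symmetric_def complement_def)
qed

lemma contains_wheelI:
  assumes F: "pair_graph F" and h: "h \<in> pverts F"
    and c: "set c \<subseteq> {u \<in> pverts F. u \<noteq> h \<and> (h, u) \<notin> parcs F}" "distinct c" "length c = 8"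
    and cyc: "\<forall>i<8. (c ! i, c ! (Suc i mod 8)) \<notin> parcs F"
  shows "contains (complement F) (wheel 8)"
proof -
  interpret F: pair_graph F by fact
  define f where "f i = (if i < 8 then c ! i else h)" for i
  have mem: "f i \<in> pverts F" "f i \<noteq> h" "(h, f i) \<notin> parcs F" "(f i, h) \<notin> parcs F" if "i < 8" for i
    using c(1,3) that F.arcs_symmetric by (auto simp: f_def subset_iff in_set_conv_nth)
  have f8: "f 8 = h" by (simp add: f_def)
  have inj: "f i = f j \<longleftrightarrow> i = j" if "i < 8" "j < 8" for i j
    using that c nth_eq_iff_index_eq[of c i j] by (simp add: f_def)
  have "inj_on f {..8}"
  proof (rule inj_onI)
    fix i j assume "i \<in> {..8::nat}" "j \<in> {..8::nat}" "f i = f j"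
    then show "i = j" using inj[of i j] mem(2)[of i] mem(2)[of j] f8
      by (cases "i = 8"; cases "j = 8") force+
  qed
  moreover have "f ` {..8} \<subseteq> pverts F"
    using mem(1) f8 h by (auto simp: le_less)
  moreover have "(f u, f v) \<in> parcs (complement F)" if "(u, v) \<in> parcs (wheel 8)" for u v
  proof -
    have edge: "(f i, f (Suc i mod 8)) \<in> parcs (complement F)" "(f (Suc i mod 8), f i) \<in> parcs (complement F)" if "i < 8" for i
    proof -
      have "Suc i mod 8 < 8" "Suc i mod 8 \<noteq> i" using that by (auto simp: mod_Suc)
      then show "(f i, f (Suc i mod 8)) \<in> parcs (complement F)" "(f (Suc i mod 8), f i) \<in> parcs (complement F)"
        using cyc that mem(1) inj[of i "Suc i mod 8"] F.arcs_symmetric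
        by (auto simp: complement_def f_def)
    qed
    have spoke: "(h, f i) \<in> parcs (complement F)" "(f i, h) \<in> parcs (complement F)" if "i < 8" for i
      using mem[OF that] h by (auto simp: complement_def)
    show ?thesis
      using that edge spoke f8 by (auto simp: wheel_def cycle_arcs_def)
  qed
  ultimately show ?thesis
    using contains_iff_embedding[OF pair_graph_complement[OF F] pair_graph_wheel[of 8]]
    by (auto simp: wheel_def complement_def)
qed

lemma contains_star_1_4I:
  assumes F: "pair_graph F" and n: "8 \<le> n" and v: "v \<in> pverts F" and P: "{p, q, r, s, t} \<subseteq> pverts F"
    and d: "distinct [v, p, q, r, s, t]"
    and e: "(v, p) \<in> parcs F" "(p, q) \<in> parcs F" "(q, r) \<in> parcs F" "(r, s) \<in> parcs F" "(s, t) \<in> parcs F"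
    and leaves: "n - 6 \<le> card ({u \<in> pverts F. (v, u) \<in> parcs F} - {p, q, r, s, t})"
  shows "contains F (star_1_4 n)"
proof -
  interpret F: pair_graph F by fact
  obtain L where L: "L \<subseteq> {u \<in> pverts F. (v, u) \<in> parcs F} - {p, q, r, s, t}" "card L = n - 6" "finite L"
    using leaves by (meson obtain_subset_with_card_n)
  have "(v, v) \<notin> parcs F" using F.no_loops[of "(v, v)"] by auto
  then have vL: "v \<notin> L" using L(1) by blast
  obtain l where l: "bij_betw l {2..<n - 4} L"
    using L by (metis card_atLeastLessThan diff_diff_left finite_atLeastLessThan finite_same_card_bij numeral_Bit0 numeral_plus_numeral add_num_simps(2) add_num_simps)
  \<comment> \<open>The path of \<open>star_1_4 n\<close> runs through
    \<open>0, n - 1, n - 2, n - 3, n - 4, 1\<close>, which are sent to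
    \<open>v, p, q, r, s, t\<close>.\<close>
  define f where "f i = (if i = 0 then v else if i = 1 then t else if i < n - 4 then l i
    else if i = n - 4 then s else if i = n - 3 then r else if i = n - 2 then q else p)" for i
  have f: "f 0 = v" "f 1 = t" "f (n - 4) = s" "f (n - 3) = r" "f (n - 2) = q" "f (n - 1) = p"
    using n by (auto simp: f_def)
  have fl: "f i = l i" if "i \<in> {2..<n - 4}" for i using that by (auto simp: f_def)
  have dom: "{..<n} = {0, 1, n - 4, n - 3, n - 2, n - 1} \<union> {2..<n - 4}" using n by auto
  have "f ` {2..<n - 4} = L" using l fl by (simp add: bij_betw_def)
  then have img: "f ` {..<n} = {v, t, s, r, q, p} \<union> L" unfolding dom image_Un by (simp add: f del: One_nat_def)
  have "{v, t, s, r, q, p} \<inter> L = {}" using L(1) vL by auto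
  then have "card (f ` {..<n}) = card {v, t, s, r, q, p} + card L"
    unfolding img using L(3) by (intro card_Un_disjoint) auto
  also have "card {v, t, s, r, q, p} = 6" using d by auto
  finally have "card (f ` {..<n}) = n" using L(2) n by simp
  then have inj: "inj_on f {..<n}" by (intro eq_card_imp_inj_on) auto
  have sub: "f ` {..<n} \<subseteq> pverts F" unfolding img using v P L(1) by auto
  have lv: "(v, f i) \<in> parcs F" if "i \<in> {2..<n - 4}" for i
    using that L(1) \<open>f ` {2..<n - 4} = L\<close> by blast
  have n6: "6 \<le> n" using n by simp
  have "(f u, f w) \<in> parcs F" if "(u, w) \<in> parcs (star_1_4 n)" for u w
  proof -
    have "(u, w) \<in> ({0} \<times> {2..<n - 4} \<union> {2..<n - 4} \<times> {0}) \<union>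
      {(0, n - 1), (n - 1, 0), (n - 1, n - 2), (n - 2, n - 1), (n - 2, n - 3), (n - 3, n - 2),
       (n - 3, n - 4), (n - 4, n - 3), (n - 4, 1), (1, n - 4)}"
      using that unfolding star_1_4_explicit(2)[OF n6] .
    then show ?thesis
      using lv e F.arcs_symmetric by (elim UnE insertE emptyE) (auto simp: f simp del: One_nat_def)
  qed
  then show ?thesis
    using inj sub contains_iff_embedding[OF F pair_graph_star_1_4[OF n6]]
    by (auto simp: star_1_4_explicit(1)[OF n6])
qed

lemma ramsey_upper:
  assumes n: "8 \<le> n" and F: "pair_graph F"
    and order: "n mod 4 \<noteq> 0 \<and> card (pverts F) = 2 * n - 1 \<or> n mod 4 = 0 \<and> card (pverts F) = 2 * n"
  shows "contains F (star_1_4 n) \<or> contains (complement F) (wheel 8)"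
proof (rule ccontr)
  assume no: "\<not> ?thesis"
  interpret F: pair_graph F by fact
  interpret tree_wheel_free "pverts F" "\<lambda>x y. (x, y) \<in> parcs F" n
  proof
    show "card ({u \<in> pverts F. (v, u) \<in> parcs F} - {p, q, r, s, t}) < n - 6"
      if "v \<in> pverts F" "{p, q, r, s, t} \<subseteq> pverts F" "distinct [v, p, q, r, s, t]" "(v, p) \<in> parcs F"
        "(p, q) \<in> parcs F" "(q, r) \<in> parcs F" "(r, s) \<in> parcs F" "(s, t) \<in> parcs F" for v p q r s t
      using contains_star_1_4I[OF F n that] no by (meson linorder_not_less)
    show False if "h \<in> pverts F" "set c \<subseteq> {u \<in> pverts F. u \<noteq> h \<and> (h, u) \<notin> parcs F}" "distinct c"
      "length c = 8" "\<forall>i<8. (c ! i, c ! (Suc i mod 8)) \<notin> parcs F" for h c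
      using contains_wheelI[OF F that] no by blast
    show "(x, x) \<notin> parcs F" for x using F.no_loops[of "(x, x)"] by auto
  qed (use n order F.arcs_symmetric in auto)
  show False by (rule contradiction)
qed

section \<open>Lower bound constructions\<close>

text \<open>With initial segments as vertex sets, a single relation \<open>E\<close> yields
  counterexamples of every order below the Ramsey number.\<close>

definition graph_on :: "(nat \<Rightarrow> nat \<Rightarrow> bool) \<Rightarrow> nat \<Rightarrow> nat pair_pre_digraph" where
  "graph_on E m = \<lparr> pverts = {..<m}, parcs = {(u, v). u < m \<and> v < m \<and> E u v} \<rparr>"

lemma pair_graph_graph_on:
  assumes "\<And>u v. E u v \<Longrightarrow> E v u" "\<And>u. \<not> E u u"
  shows "pair_graph (graph_on E m)"
proof -
  have "parcs (graph_on E m) \<subseteq> {..<m} \<times> {..<m}" by (auto simp: graph_on_def)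
  then have "finite (parcs (graph_on E m))" by (rule finite_subset) simp
  moreover have "sym (parcs (graph_on E m))" by (rule symI) (use assms in \<open>auto simp: graph_on_def\<close>)
  ultimately show ?thesis
    using assms by unfold_locales (auto simp: symmetric_def graph_on_def)
qed

text \<open>Connectedness of the tree is expressed through functions that are constant along
  edges.\<close>

lemma star_1_4_connected:
  assumes n: "8 \<le> n" and P: "\<And>u v. (u, v) \<in> parcs (star_1_4 n) \<Longrightarrow> P u = P v" and i: "i < n"
  shows "P i = P 0"
proof -
  have n6: "6 \<le> n" using n by simp
  note arcs = star_1_4_explicit(2)[OF n6]
  have P': "P (n - 1) = P 0" "P (n - 2) = P (n - 1)" "P (n - 3) = P (n - 2)" "P (n - 4) = P (n - 3)" "P 1 = P (n - 4)"
    by (rule P; unfold arcs; blast)+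
  have "P i = P 0" if "i \<in> {2..<n - 4}" by (rule P, unfold arcs) (use that in blast)
  moreover have "i \<in> {2..<n - 4} \<or> i = 0 \<or> i = 1 \<or> i = n - 4 \<or> i = n - 3 \<or> i = n - 2 \<or> i = n - 1"
    using i by auto
  ultimately show ?thesis using P' by auto
qed

definition two_cliques :: "nat \<Rightarrow> nat \<Rightarrow> nat \<Rightarrow> bool" where
  "two_cliques k u v \<longleftrightarrow> u \<noteq> v \<and> (u < k \<longleftrightarrow> v < k)"

definition clique_and_multipartite :: "nat \<Rightarrow> nat \<Rightarrow> nat \<Rightarrow> bool" where
  "clique_and_multipartite k u v \<longleftrightarrow>
    two_cliques k u v \<and> (k \<le> u \<longrightarrow> (u - k) div 4 \<noteq> (v - k) div 4)"

lemma pair_graph_lower: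
  "pair_graph (graph_on (two_cliques k) m)" "pair_graph (graph_on (clique_and_multipartite k) m)"
  by (rule pair_graph_graph_on; auto simp: two_cliques_def clique_and_multipartite_def)+

text \<open>The connected tree stays on one side, and the clique on \<open>n - 1\<close> vertices is
  too small for it.\<close>

lemma tree_in_large_side:
  assumes n: "8 \<le> n" and inj: "inj_on f {..<n}" and f: "\<And>i. i < n \<Longrightarrow> f i < m"
    and e: "\<And>u v. (u, v) \<in> parcs (star_1_4 n) \<Longrightarrow> two_cliques (n - 1) (f u) (f v)"
  shows "f ` {..<n} \<subseteq> {n - 1..<m}"
proof -
  have side: "(f i < n - 1) = (f 0 < n - 1)" if "i < n" for i
    by (rule star_1_4_connected[OF n _ that]) (use e in \<open>auto simp: two_cliques_def\<close>)
  have "\<not> f 0 < n - 1"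
  proof
    assume "f 0 < n - 1"
    then have "f ` {..<n} \<subseteq> {..<n - 1}" using side by auto
    then have "card {..<n} \<le> card {..<n - 1}" by (rule card_inj_on_le[OF inj]) simp
    then show False using n by simp
  qed
  then show ?thesis using side f by fastforce
qed

lemma no_tree_two_cliques:
  assumes n: "8 \<le> n" and m: "m \<le> 2 * n - 2"
  shows "\<not> contains (graph_on (two_cliques (n - 1)) m) (star_1_4 n)"
proof
  have n6: "6 \<le> n" using n by simp
  assume "contains (graph_on (two_cliques (n - 1)) m) (star_1_4 n)"
  then obtain f where f: "inj_on f {..<n}" "f ` {..<n} \<subseteq> {..<m}"
    "\<And>u v. (u, v) \<in> parcs (star_1_4 n) \<Longrightarrow> two_cliques (n - 1) (f u) (f v)"
    using contains_iff_embedding[OF pair_graph_lower(1) pair_graph_star_1_4[OF n6]]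
    by (auto simp: graph_on_def star_1_4_explicit(1)[OF n6])
  have "f ` {..<n} \<subseteq> {n - 1..<m}" by (rule tree_in_large_side[OF n f(1) _ f(3)]) (use f(2) in auto)
  then have "card {..<n} \<le> card {n - 1..<m}" by (rule card_inj_on_le[OF f(1)]) simp
  then show False using n m by simp
qed

text \<open>The tree would fill the whole multipartite side and hence the part of its centre, a full
  block of four since 4 divides \<open>n\<close>. But besides the centre, this part can contain at
  most one vertex of each edge \<open>{n - 4, 1}\<close> and \<open>{n - 2, n - 3}\<close>.\<close>

lemma no_tree_multipartite:
  assumes n: "8 \<le> n" and n4: "n mod 4 = 0" and m: "m \<le> 2 * n - 1"
  shows "\<not> contains (graph_on (clique_and_multipartite (n - 1)) m) (star_1_4 n)"
proof
  have n6: "6 \<le> n" using n by simp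
  define b where "b x = (x - (n - 1)) div 4" for x
  assume "contains (graph_on (clique_and_multipartite (n - 1)) m) (star_1_4 n)"
  then obtain f where f: "inj_on f {..<n}" "f ` {..<n} \<subseteq> {..<m}"
    "\<And>u v. (u, v) \<in> parcs (star_1_4 n) \<Longrightarrow> clique_and_multipartite (n - 1) (f u) (f v)"
    using contains_iff_embedding[OF pair_graph_lower(2) pair_graph_star_1_4[OF n6]]
    by (auto simp: graph_on_def star_1_4_explicit(1)[OF n6])
  have "f ` {..<n} \<subseteq> {n - 1..<m}"
    by (rule tree_in_large_side[OF n f(1)]) (use f(2,3) in \<open>auto simp: clique_and_multipartite_def\<close>)
  then have sub: "f ` {..<n} \<subseteq> {n - 1..<2 * n - 1}" using m by auto
  have img: "f ` {..<n} = {n - 1..<2 * n - 1}"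
    by (rule card_subset_eq) (use sub card_image[OF f(1)] n in auto)
  have e: "b (f u) \<noteq> b (f v)" if "(u, v) \<in> parcs (star_1_4 n)" "u < n" for u v
    using f(3)[OF that(1)] sub that(2) by (auto simp: b_def clique_and_multipartite_def)
  define J where "J = {i. i < n \<and> b (f i) = b (f 0)}"
  have "f 0 \<in> {n - 1..<2 * n - 1}" using sub n by (simp add: image_subset_iff)
  then have y: "f 0 = n - 1 + y" "y < n" if "y = f 0 - (n - 1)" for y using that by auto
  define y where "y = f 0 - (n - 1)"
  note y = y[OF y_def]
  have "y div 4 * 4 + 4 \<le> n" using y(2) n4 by presburger
  define B where "B = {n - 1 + y div 4 * 4..<n - 1 + y div 4 * 4 + 4}"
  have "B \<subseteq> f ` {..<n}" unfolding img B_def using \<open>y div 4 * 4 + 4 \<le> n\<close> by auto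
  moreover have "b x = b (f 0)" if "x \<in> B" for x
    using that y(1) by (auto simp: B_def b_def)
  ultimately have "B \<subseteq> f ` J" by (auto simp: J_def)
  moreover have finJ: "finite J" by (simp add: J_def)
  ultimately have "card B \<le> card J" by (meson surj_card_le)
  then have J4: "4 \<le> card J" by (simp add: B_def)
  note arcs = star_1_4_explicit(2)[OF n6]
  have n0: "i \<notin> J" if "i \<in> {2..<n - 4} \<union> {n - 1}" for i
    using e[of 0 i] that n unfolding arcs by (auto simp: J_def)
  have pairs: "\<not> (n - 4 \<in> J \<and> 1 \<in> J)" "\<not> (n - 2 \<in> J \<and> n - 3 \<in> J)"
    using e[of "n - 4" 1] e[of "n - 2" "n - 3"] n unfolding arcs by (auto simp: J_def)
  have "J \<subseteq> {0} \<union> ({n - 4, 1} \<inter> J) \<union> ({n - 2, n - 3} \<inter> J)"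
  proof
    fix i assume "i \<in> J"
    then have "i < n" "i \<notin> {2..<n - 4} \<union> {n - 1}" using n0 by (auto simp: J_def)
    then have "i = 0 \<or> i = 1 \<or> i = n - 4 \<or> i = n - 3 \<or> i = n - 2" by auto
    then show "i \<in> {0} \<union> ({n - 4, 1} \<inter> J) \<union> ({n - 2, n - 3} \<inter> J)" using \<open>i \<in> J\<close> by auto
  qed
  then have "card J \<le> card ({0} \<union> ({n - 4, 1} \<inter> J) \<union> ({n - 2, n - 3} \<inter> J))" by (intro card_mono) auto
  also have "\<dots> \<le> card {0::nat} + card ({n - 4, 1} \<inter> J) + card ({n - 2, n - 3} \<inter> J)"
    by (intro order_trans[OF card_Un_le] add_mono card_Un_le order_refl)
  also have "card ({n - 4, 1} \<inter> J) \<le> 1" using pairs(1) by (auto simp: Int_insert_left)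
  also have "card ({n - 2, n - 3} \<inter> J) \<le> 1" using pairs(2) by (auto simp: Int_insert_left)
  finally show False using J4 by simp
qed

lemma wheel_embedding:
  assumes "pair_graph (graph_on E m)" "contains (complement (graph_on E m)) (wheel 8)"
  shows "\<exists>f. inj_on f {..8} \<and> (\<forall>i<8. \<not> E (f 8) (f i)) \<and> (\<forall>i<8. \<not> E (f i) (f (Suc i mod 8)))"
proof -
  obtain f where f: "inj_on f (pverts (wheel 8))" "f ` pverts (wheel 8) \<subseteq> {..<m}"
    and e: "\<And>u v. (u, v) \<in> parcs (wheel 8) \<Longrightarrow> (f u, f v) \<in> parcs (complement (graph_on E m))"
    using contains_iff_embedding[OF pair_graph_complement[OF assms(1)] pair_graph_wheel[of 8]] assms(2)
    by (auto simp: complement_def graph_on_def)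
  have "(8, i) \<in> parcs (wheel 8)" "(i, Suc i mod 8) \<in> parcs (wheel 8)" if "i < 8" for i
    using that by (auto simp: wheel_def cycle_arcs_def)
  then show ?thesis
    using f(1) e by (intro exI[of _ f]) (fastforce simp: wheel_def complement_def graph_on_def)
qed

text \<open>The complement is bipartite, whereas the hub and two consecutive rim vertices form a
  triangle.\<close>

lemma no_wheel_two_cliques: "\<not> contains (complement (graph_on (two_cliques k) m)) (wheel 8)"
proof
  assume "contains (complement (graph_on (two_cliques k) m)) (wheel 8)"
  then obtain f where f: "inj_on f {..8}" "\<And>i. i < 8 \<Longrightarrow> \<not> two_cliques k (f 8) (f i)"
    "\<And>i. i < 8 \<Longrightarrow> \<not> two_cliques k (f i) (f (Suc i mod 8))"
    using wheel_embedding[OF pair_graph_lower(1)] by blast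
  have "f 8 \<noteq> f 0" "f 8 \<noteq> f 1" "f 0 \<noteq> f 1"
    using inj_onD[OF f(1), of 8 0] inj_onD[OF f(1), of 8 1] inj_onD[OF f(1), of 0 1] by auto
  then show False using f(2)[of 0] f(2)[of 1] f(3)[of 0] by (auto simp: two_cliques_def)
qed

text \<open>No two consecutive rim vertices lie in the clique. With the hub outside the clique, four
  disjoint rim pairs each put a vertex into its block, giving five vertices there. With the hub in
  the clique, the whole rim lies in one block.\<close>

lemma no_wheel_multipartite: "\<not> contains (complement (graph_on (clique_and_multipartite k) m)) (wheel 8)"
proof
  assume "contains (complement (graph_on (clique_and_multipartite k) m)) (wheel 8)"
  then obtain f where inj: "inj_on f {..8}" and hub: "\<And>i. i < 8 \<Longrightarrow> \<not> clique_and_multipartite k (f 8) (f i)"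
    and cyc: "\<And>i. i < 8 \<Longrightarrow> \<not> clique_and_multipartite k (f i) (f (Suc i mod 8))"
    using wheel_embedding[OF pair_graph_lower(2)] by blast
  define b where "b x = (x - k) div 4" for x
  have neq: "f i \<noteq> f j" if "i \<le> 8" "j \<le> 8" "i \<noteq> j" for i j
    using inj_onD[OF inj, of i j] that by auto
  have small: "card S \<le> 4" if S: "S \<subseteq> {..8}" "\<And>i. i \<in> S \<Longrightarrow> k \<le> f i \<and> b (f i) = c" for S c
  proof -
    have "f ` S \<subseteq> {k + 4 * c..<k + 4 * c + 4}"
      using S(2) by (force simp: b_def)
    then have "card S \<le> card {k + 4 * c..<k + 4 * c + 4}"
      by (rule card_inj_on_le[OF inj_on_subset[OF inj S(1)]]) simp
    then show ?thesis by simp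
  qed
  have step: "k \<le> f i \<or> k \<le> f (Suc i)" if "i < 7" for i
    using cyc[of i] neq[of i "Suc i"] that by (auto simp: clique_and_multipartite_def two_cliques_def)
  show False
  proof (cases "k \<le> f 8")
    case True
    have block: "b (f i) = b (f 8)" if "i < 8" "k \<le> f i" for i
      using hub[OF that(1)] neq[of 8 i] that True
      by (auto simp: clique_and_multipartite_def two_cliques_def b_def)
    obtain a1 where a1: "a1 \<in> {0, 1}" "k \<le> f a1" using step[of 0] by auto
    obtain a2 where a2: "a2 \<in> {2, 3}" "k \<le> f a2" using step[of 2] by (auto simp: numeral_eq_Suc)
    obtain a3 where a3: "a3 \<in> {4, 5}" "k \<le> f a3" using step[of 4] by (auto simp: numeral_eq_Suc)
    obtain a4 where a4: "a4 \<in> {6, 7}" "k \<le> f a4" using step[of 6] by (auto simp: numeral_eq_Suc)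
    have "card {a1, a2, a3, a4, 8} \<le> 4"
      by (rule small[of _ "b (f 8)"]) (use a1 a2 a3 a4 block True in auto)
    moreover have "distinct [a1, a2, a3, a4, 8]" using a1 a2 a3 a4 by auto
    then have "card {a1, a2, a3, a4, 8} = 5" using distinct_card[of "[a1, a2, a3, a4, 8]"] by simp
    ultimately show False by simp
  next
    case small_hub: False
    have big: "k \<le> f i" if "i < 8" for i
      using hub[OF that] neq[of 8 i] that small_hub
      by (auto simp: clique_and_multipartite_def two_cliques_def)
    have same: "b (f i) = b (f 0)" if "i < 8" for i
      using that
    proof (induction i)
      case (Suc i)
      then have "b (f (Suc i)) = b (f i)"
        using cyc[of i] neq[of i "Suc i"] big[of i] big[of "Suc i"]
        by (auto simp: clique_and_multipartite_def two_cliques_def b_def)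
      then show ?case using Suc by simp
    qed simp
    have "card {..<8::nat} \<le> 4"
    proof (rule small)
      show "k \<le> f i \<and> b (f i) = b (f 0)" if "i \<in> {..<8}" for i using big[of i] same[of i] that by simp
    qed auto
    then show False by simp
  qed
qed

text \<open>The minimum in \<open>ramsey_number\<close> is over all orders, so every
  \<open>m < N\<close> has to be refuted, not only \<open>N - 1\<close>.\<close>

lemma ramsey_number_eqI:
  assumes upper: "\<And>F :: nat pair_pre_digraph. pair_graph F \<Longrightarrow> card (pverts F) = N \<Longrightarrow>
      contains F G \<or> contains (complement F) H"
    and lower: "\<And>m. m < N \<Longrightarrow> pair_graph (graph_on E m) \<and>
      \<not> contains (graph_on E m) G \<and> \<not> contains (complement (graph_on E m)) H"
  shows "ramsey_number G H = N"
  unfolding ramsey_number_def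
proof (rule Least_equality)
  fix m assume m: "\<forall>F :: nat pair_pre_digraph. pair_graph F \<and> card (pverts F) = m \<longrightarrow> contains F G \<or> contains (complement F) H"
  show "N \<le> m"
  proof (rule ccontr)
    assume "\<not> N \<le> m"
    then show False using m lower[of m] by (auto simp: graph_on_def dest!: spec[of _ "graph_on E m"])
  qed
qed (use upper in blast)

theorem theorem18:
  fixes n :: nat
  assumes "n \<ge> 8"
  shows "(n mod 4 \<noteq> 0 \<longrightarrow> ramsey_number (star_1_4 n) (wheel 8) = 2 * n - 1) \<and>
         (n mod 4 = 0 \<longrightarrow> ramsey_number (star_1_4 n) (wheel 8) = 2 * n)"
proof (intro conjI impI)
  assume "n mod 4 \<noteq> 0"
  then show "ramsey_number (star_1_4 n) (wheel 8) = 2 * n - 1"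
    using ramsey_upper[OF assms] pair_graph_lower(1) no_tree_two_cliques[OF assms] no_wheel_two_cliques
    by (intro ramsey_number_eqI[where E = "two_cliques (n - 1)"]) auto
next
  assume "n mod 4 = 0"
  then show "ramsey_number (star_1_4 n) (wheel 8) = 2 * n"
    using ramsey_upper[OF assms] pair_graph_lower(2) no_tree_multipartite[OF assms] no_wheel_multipartite
    by (intro ramsey_number_eqI[where E = "clique_and_multipartite (n - 1)"]) auto
qed
end
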